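(* Let $X$ be a set and $(\Omega,\leftarrow,\rightarrow,\lhd,\rhd)$ an extended diassociative semigroup. With respect to the monomial order $\leq_{\mathrm{db}}$ on $\mathfrak{M}(\Omega,X)$: (a) the set $$\mathbb{S}_\Omega=\Big\{\lfloor u\rfloor_\alpha\lfloor v\rfloor_\beta-\big\lfloor\lfloor u\rfloor_{\alpha\rhd\beta}\,v\big\rfloor_{\alpha\rightarrow\beta}-\big\lfloor u\,\lfloor v\rfloor_{\alpha\lhd\beta}\big\rfloor_{\alpha\leftarrow\beta}\ \Big|\ u,v\in\mathfrak{M}(\Omega,X),\ \alpha,\beta\in\Omega\Big\}$$ is a Gröbner-Shirshov basis in $\mathbf{k}\mathfrak{M}(\Omega,X)$; (b) the set $$\mathrm{Irr}(\mathbb{S}_\Omega)=\{w\in\mathfrak{M}(\Omega,X)\mid w\neq q|_{\overline{s}}\text{ for any }q\in\mathfrak{M}^\star(\Omega,X)\text{ and any }s\in\mathbb{S}_\Omega\}$$ is a $\mathbf{k}$-basis of the free $\Omega$-Rota-Baxter algebra $\mathbf{k}\mathfrak{M}(\Omega,X)/\mathrm{Id}(\mathbb{S}_\Omega)$ of weight zero on $X$.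
   Context: $\mathbf{k}$ is a fixed commutative unitary ring; algebras are unitary associative $\mathbf{k}$-algebras. **$\Omega$-Rota-Baxter algebra of weight zero.** For a nonempty set $\Omega$ with four binary operations $\leftarrow,\rightarrow,\lhd,\rhd$, this is an algebra $A$ with linear operators $R_\omega:A\to A$ ($\omega\in\Omega$) such that for all $a,b\in A$, $\alpha,\beta\in\Omega$: $R_\alpha(a)R_\beta(b)=R_{\alpha\rightarrow\beta}(R_{\alpha\rhd\beta}(a)b)+R_{\alpha\leftarrow\beta}(aR_{\alpha\lhd\beta}(b))$. **Extended diassociative semigroup.** A nonempty set $\Omega$ with four binary operations such that for all $\alpha,\beta,\gamma\in\Omega$: $(\alpha\rightarrow\beta)\rightarrow\gamma=\alpha\rightarrow(\beta\rightarrow\gamma)$; $(\alpha\rightarrow\beta)\rhd\gamma=(\alpha\rhd(\beta\rightarrow\gamma))\rightarrow(\beta\rhd\gamma)$; $\alpha\rhd\beta=(\alpha\rhd(\beta\rightarrow\gamma))\rhd(\beta\rhd\gamma)$; $(\alpha\rightarrow\beta)\leftarrow\gamma=\alpha\rightarrow(\beta\leftarrow\gamma)$; $\alpha\rhd(\beta\leftarrow\gamma)=\alpha\rhd\beta$; $(\alpha\rightarrow\beta)\lhd\gamma=\beta\lhd\gamma$; $(\alpha\leftarrow\beta)\rightarrow\gamma=\alpha\rightarrow(\beta\rightarrow\gamma)$; $(\alpha\rhd(\beta\rightarrow\gamma))\leftarrow(\beta\rhd\gamma)=(\alpha\leftarrow\beta)\rhd\gamma$; $(\alpha\rhd(\beta\rightarrow\gamma))\lhd(\beta\rhd\gamma)=\alpha\lhd\beta$;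 $(\alpha\leftarrow\beta)\leftarrow\gamma=\alpha\leftarrow(\beta\rightarrow\gamma)$; $(\alpha\lhd\beta)\rightarrow((\alpha\leftarrow\beta)\lhd\gamma)=\alpha\lhd(\beta\rightarrow\gamma)$; $(\alpha\lhd\beta)\rhd((\alpha\leftarrow\beta)\lhd\gamma)=\beta\rhd\gamma$; $(\alpha\leftarrow\beta)\leftarrow\gamma=\alpha\leftarrow(\beta\leftarrow\gamma)$; $(\alpha\lhd\beta)\leftarrow((\alpha\leftarrow\beta)\lhd\gamma)=\alpha\lhd(\beta\leftarrow\gamma)$; $(\alpha\lhd\beta)\lhd((\alpha\leftarrow\beta)\lhd\gamma)=\beta\lhd\gamma$. **Bracketed words.** Let $M(Y)$ be the free monoid on $Y$ and, for $\omega\in\Omega$, let $\lfloor Y\rfloor_\omega=\{\lfloor y\rfloor_\omega\mid y\in Y\}$ be a disjoint copy of $Y$ (disjoint for different $\omega$). Set $\mathfrak{M}_0=M(X)$, $\mathfrak{M}_n=M(X\sqcup\bigsqcup_{\omega\in\Omega}\lfloor\mathfrak{M}_{n-1}\rfloor_\omega)$, with the natural inclusions $\mathfrak{M}_{n-1}\hookrightarrow\mathfrak{M}_n$, and $\mathfrak{M}(\Omega,X)=\bigcup_n\mathfrak{M}_n$, a monoid with identity $1$. $\mathbf{k}\mathfrak{M}(\Omega,X)$ is the free module on it, with multiplication extended linearly and linear operators $w\mapsto\lfloor w\rfloor_\omega$; it is the free algebra on $X$ equipped with a family of linear operators indexed by $\Omega$. Elements of $X\sqcup\bigsqcup_\omega\lfloor\mathfrak{M}(\Omega,X)\rfloor_\omega$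 are called prime; if $u=u_1\cdots u_n$ with $u_i$ prime, the breadth is $|u|=n$ (and $|1|=0$). $\mathfrak{M}^\star(\Omega,X)$ is the set of words in $\mathfrak{M}(\Omega,X\sqcup\{\star\})$ in which $\star$ occurs exactly once; $q|_u$ is obtained from $q$ by replacing $\star$ by $u$, extended linearly in $u$. $\mathrm{Id}(\mathbb{S})$ is the two-sided ideal, closed under all operators $\lfloor\,\rfloor_\omega$, generated by $\mathbb{S}$. In the quotient, $R_\omega$ is the operator induced by $\lfloor\,\rfloor_\omega$. **The order $\leq_{\mathrm{db}}$.** Fix well orders $\leq_X$ on $X$ and $\leq_\Omega$ on the set of operators $\{\lfloor\,\rfloor_\omega\mid\omega\in\Omega\}$. Let $\deg(u)$ be the total number of occurrences in $u$ of letters of $X$ and of operators, counted with multiplicity. For $u=u_1\cdots u_m$, $v=v_1\cdots v_n$ with prime factors $u_i,v_j$, $u\leq_{\mathrm{db}}v$ is defined recursively by lexicographic comparison of $(\deg(u),|u|,u_1,\dots,u_m)$ and $(\deg(v),|v|,v_1,\dots,v_n)$, i.e. first by degree, then by breadth, then by prime factors lexicographically; two prime elements of equal degree are compared as follows: elements of $X$ by $\leq_X$; an element of $X$ is smaller than any bracket; two brackets $\lfloor\tilde u\rfloor_\alpha,\lfloor\tilde v\rfloor_\beta$ by lexicographic comparison of $(\lfloor\,\rfloor_\alpha,\tilde u)$ and $(\lfloor\,\rfloor_\beta,\tilde v)$, using $\leq_\Omega$ and then $\leq_{\mathrm{db}}$. **Gröbner-Shirshov basis.** A monomial order is a well order $\leq$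 on $\mathfrak{M}(\Omega,X)$ such that $u<v$ implies $q|_u<q|_v$ for all $q\in\mathfrak{M}^\star(\Omega,X)$. Given one, $\overline{f}$ denotes the leading monomial of $f\neq0$; $f$ is monic if its leading coefficient is $1$. Let $f,g$ be distinct monic elements. If $w=\overline{f}u=v\overline{g}$ for words $u,v,w$ with $\max\{|\overline f|,|\overline g|\}<|w|<|\overline f|+|\overline g|$, then $fu-vg$ is an intersection composition of $f,g$ with ambiguity $w$. If $w=\overline f=q|_{\overline g}$ with $q\in\mathfrak{M}^\star(\Omega,X)$, then $f-q|_g$ is an including composition with ambiguity $w$. For a set $\mathbb{S}$ of monic elements, a composition $h$ with ambiguity $w$ is trivial modulo $(\mathbb{S},w)$ if $h=\sum_ic_iq_i|_{s_i}$ (finite sum) with $c_i\in\mathbf{k}\setminus\{0\}$, $q_i\in\mathfrak{M}^\star(\Omega,X)$, $s_i\in\mathbb{S}$, $q_i|_{\overline{s_i}}<w$. $\mathbb{S}$ is a Gröbner-Shirshov basis if all intersection and including compositions of all pairs $f,g\in\mathbb{S}$ are trivial modulo $(\mathbb{S},w)$. *)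

theory Defs
  imports
    "HOL-Algebra.Module"
    "HOL-Algebra.QuotRing"
    "HOL-Algebra.Algebraic_Closure_Type"
    "HOL-Library.Poly_Mapping"
begin

(* Frees the letter X for use as a variable. *)
no_notation var (\<open>X\<index>\<close>)

text \<open>
  Conventions. The coefficient ring is a type \<open>'k :: comm_ring_1\<close>. The index set \<open>\<Omega>\<close> is
  nonempty, so it is represented by a type \<open>'w\<close>; the set \<open>X\<close> of generators may be empty, so it is a
  set \<open>X :: 'x set\<close>. Algebras are carrier-based records in the style of HOL-Algebra.
\<close>


section \<open>Extended diassociative semigroups\<close>

record 'w four_ops =
  larr :: "'w \<Rightarrow> 'w \<Rightarrow> 'w"  (infixl \<open>\<^bold>\<leftarrow>\<index>\<close> 70)
  rarr :: "'w \<Rightarrow> 'w \<Rightarrow> 'w"  (infixl \<open>\<^bold>\<rightarrow>\<index>\<close> 70)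
  ltri :: "'w \<Rightarrow> 'w \<Rightarrow> 'w"  (infixl \<open>\<^bold>\<lhd>\<index>\<close> 70)
  rtri :: "'w \<Rightarrow> 'w \<Rightarrow> 'w"  (infixl \<open>\<^bold>\<rhd>\<index>\<close> 70)

locale ext_diassociative_semigroup =
  fixes Om :: "'w four_ops" (structure)
  assumes eds1:  "(\<alpha> \<^bold>\<rightarrow> \<beta>) \<^bold>\<rightarrow> \<gamma> = \<alpha> \<^bold>\<rightarrow> (\<beta> \<^bold>\<rightarrow> \<gamma>)"
    and eds2:  "(\<alpha> \<^bold>\<rightarrow> \<beta>) \<^bold>\<rhd> \<gamma> = (\<alpha> \<^bold>\<rhd> (\<beta> \<^bold>\<rightarrow> \<gamma>)) \<^bold>\<rightarrow> (\<beta> \<^bold>\<rhd> \<gamma>)"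
    and eds3:  "\<alpha> \<^bold>\<rhd> \<beta> = (\<alpha> \<^bold>\<rhd> (\<beta> \<^bold>\<rightarrow> \<gamma>)) \<^bold>\<rhd> (\<beta> \<^bold>\<rhd> \<gamma>)"
    and eds4:  "(\<alpha> \<^bold>\<rightarrow> \<beta>) \<^bold>\<leftarrow> \<gamma> = \<alpha> \<^bold>\<rightarrow> (\<beta> \<^bold>\<leftarrow> \<gamma>)"
    and eds5:  "\<alpha> \<^bold>\<rhd> (\<beta> \<^bold>\<leftarrow> \<gamma>) = \<alpha> \<^bold>\<rhd> \<beta>"
    and eds6:  "(\<alpha> \<^bold>\<rightarrow> \<beta>) \<^bold>\<lhd> \<gamma> = \<beta> \<^bold>\<lhd> \<gamma>"
    and eds7:  "(\<alpha> \<^bold>\<leftarrow> \<beta>) \<^bold>\<rightarrow> \<gamma> = \<alpha> \<^bold>\<rightarrow> (\<beta> \<^bold>\<rightarrow> \<gamma>)"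
    and eds8:  "(\<alpha> \<^bold>\<rhd> (\<beta> \<^bold>\<rightarrow> \<gamma>)) \<^bold>\<leftarrow> (\<beta> \<^bold>\<rhd> \<gamma>) = (\<alpha> \<^bold>\<leftarrow> \<beta>) \<^bold>\<rhd> \<gamma>"
    and eds9:  "(\<alpha> \<^bold>\<rhd> (\<beta> \<^bold>\<rightarrow> \<gamma>)) \<^bold>\<lhd> (\<beta> \<^bold>\<rhd> \<gamma>) = \<alpha> \<^bold>\<lhd> \<beta>"
    and eds10: "(\<alpha> \<^bold>\<leftarrow> \<beta>) \<^bold>\<leftarrow> \<gamma> = \<alpha> \<^bold>\<leftarrow> (\<beta> \<^bold>\<rightarrow> \<gamma>)"
    and eds11: "(\<alpha> \<^bold>\<lhd> \<beta>) \<^bold>\<rightarrow> ((\<alpha> \<^bold>\<leftarrow> \<beta>) \<^bold>\<lhd> \<gamma>) = \<alpha> \<^bold>\<lhd> (\<beta> \<^bold>\<rightarrow> \<gamma>)"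
    and eds12: "(\<alpha> \<^bold>\<lhd> \<beta>) \<^bold>\<rhd> ((\<alpha> \<^bold>\<leftarrow> \<beta>) \<^bold>\<lhd> \<gamma>) = \<beta> \<^bold>\<rhd> \<gamma>"
    and eds13: "(\<alpha> \<^bold>\<leftarrow> \<beta>) \<^bold>\<leftarrow> \<gamma> = \<alpha> \<^bold>\<leftarrow> (\<beta> \<^bold>\<leftarrow> \<gamma>)"
    and eds14: "(\<alpha> \<^bold>\<lhd> \<beta>) \<^bold>\<leftarrow> ((\<alpha> \<^bold>\<leftarrow> \<beta>) \<^bold>\<lhd> \<gamma>) = \<alpha> \<^bold>\<lhd> (\<beta> \<^bold>\<leftarrow> \<gamma>)"
    and eds15: "(\<alpha> \<^bold>\<lhd> \<beta>) \<^bold>\<lhd> ((\<alpha> \<^bold>\<leftarrow> \<beta>) \<^bold>\<lhd> \<gamma>) = \<beta> \<^bold>\<lhd> \<gamma>"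


section \<open>Operated algebras and Rota-Baxter algebras\<close>

record ('k, 'a, 'w) operated_algebra = "('k, 'a) module" +
  oper :: "'w \<Rightarrow> 'a \<Rightarrow> 'a"

text \<open>The locale \<open>algebra\<close> of the library is not used because it requires commutativity.\<close>

locale operated_algebra =
  fixes A :: "('k::comm_ring_1, 'a, 'w) operated_algebra" (structure)
  assumes is_ring: "ring A"
    and is_module: "module (ring_of_type_algebra :: 'k ring) A"
    and smult_mult_left:
      "\<And>c x y. x \<in> carrier A \<Longrightarrow> y \<in> carrier A \<Longrightarrow> (c \<odot> x) \<otimes> y = c \<odot> (x \<otimes> y)"
    and smult_mult_right:
      "\<And>c x y. x \<in> carrier A \<Longrightarrow> y \<in> carrier A \<Longrightarrow> x \<otimes> (c \<odot> y) = c \<odot> (x \<otimes> y)"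
    and oper_closed: "\<And>\<omega> x. x \<in> carrier A \<Longrightarrow> oper A \<omega> x \<in> carrier A"
    and oper_add:
      "\<And>\<omega> x y. x \<in> carrier A \<Longrightarrow> y \<in> carrier A \<Longrightarrow>
        oper A \<omega> (x \<oplus> y) = oper A \<omega> x \<oplus> oper A \<omega> y"
    and oper_smult: "\<And>\<omega> c x. x \<in> carrier A \<Longrightarrow> oper A \<omega> (c \<odot> x) = c \<odot> oper A \<omega> x"

locale Omega_RB_algebra = operated_algebra A
  for Om :: "'w four_ops" and A :: "('k::comm_ring_1, 'a, 'w) operated_algebra" (structure) +
  assumes rota_baxter:
    "\<And>\<alpha> \<beta> a b. a \<in> carrier A \<Longrightarrow> b \<in> carrier A \<Longrightarrow>
      oper A \<alpha> a \<otimes> oper A \<beta> b =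
        oper A (\<alpha> \<^bold>\<rightarrow>\<^bsub>Om\<^esub> \<beta>) (oper A (\<alpha> \<^bold>\<rhd>\<^bsub>Om\<^esub> \<beta>) a \<otimes> b)
        \<oplus> oper A (\<alpha> \<^bold>\<leftarrow>\<^bsub>Om\<^esub> \<beta>) (a \<otimes> oper A (\<alpha> \<^bold>\<lhd>\<^bsub>Om\<^esub> \<beta>) b)"

definition operated_hom ::
  "('k, 'a, 'w) operated_algebra \<Rightarrow> ('k, 'b, 'w) operated_algebra \<Rightarrow> ('a \<Rightarrow> 'b) set" where
  "operated_hom A B = {\<phi> \<in> ring_hom A B.
     (\<forall>c. \<forall>x\<in>carrier A. \<phi> (c \<odot>\<^bsub>A\<^esub> x) = c \<odot>\<^bsub>B\<^esub> \<phi> x) \<and>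
     (\<forall>\<omega>. \<forall>x\<in>carrier A. \<phi> (oper A \<omega> x) = oper B \<omega> (\<phi> x))}"

text \<open>
  The type argument is the type of the elements of the test algebras: HOL cannot quantify over types
  inside a formula, but a theorem about \<open>TYPE('a)\<close> with \<open>'a\<close> arbitrary covers all test algebras.
\<close>

definition free_Omega_RB_algebra ::
  "'a itself \<Rightarrow> 'w four_ops \<Rightarrow> 'x set \<Rightarrow> ('x \<Rightarrow> 'b) \<Rightarrow>
    ('k::comm_ring_1, 'b, 'w) operated_algebra \<Rightarrow> bool" where
  "free_Omega_RB_algebra T Om X emb F \<longleftrightarrow>
     Omega_RB_algebra Om F \<and> emb \<in> X \<rightarrow> carrier F \<and>
     (\<forall>A :: ('k, 'a, 'w) operated_algebra. Omega_RB_algebra Om A \<longrightarrow>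
       (\<forall>f \<in> X \<rightarrow> carrier A.
         \<exists>!\<phi>. \<phi> \<in> operated_hom F A \<and> \<phi> \<in> extensional (carrier F) \<and> (\<forall>x\<in>X. \<phi> (emb x) = f x)))"

definition operated_ideal :: "'a set \<Rightarrow> ('k, 'a, 'w) operated_algebra \<Rightarrow> bool" where
  "operated_ideal I A \<longleftrightarrow> ideal I A \<and> (\<forall>\<omega>. \<forall>f\<in>I. oper A \<omega> f \<in> I)"

definition gen_operated_ideal :: "('k, 'a, 'w) operated_algebra \<Rightarrow> 'a set \<Rightarrow> 'a set" where
  "gen_operated_ideal A S = \<Inter>{I. operated_ideal I A \<and> S \<subseteq> I}"

definition quotient_algebra ::
  "('k, 'a, 'w) operated_algebra \<Rightarrow> 'a set \<Rightarrow> ('k, 'a set, 'w) operated_algebra" where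
  "quotient_algebra A I =
     \<lparr>carrier = carrier (A Quot I), monoid.mult = (\<otimes>\<^bsub>A Quot I\<^esub>), one = \<one>\<^bsub>A Quot I\<^esub>,
      ring.zero = \<zero>\<^bsub>A Quot I\<^esub>, add = (\<oplus>\<^bsub>A Quot I\<^esub>),
      module.smult = (\<lambda>c C. \<Union>f\<in>C. I +>\<^bsub>A\<^esub> (c \<odot>\<^bsub>A\<^esub> f)),
      oper = (\<lambda>\<omega> C. \<Union>f\<in>C. I +>\<^bsub>A\<^esub> oper A \<omega> f)\<rparr>"

text \<open>A family \<open>b\<close> indexed by \<open>I\<close> is a basis if it spans and is linearly independent.\<close>

definition is_basis ::
  "('k::zero, 'a, 'm) module_scheme \<Rightarrow> ('i \<Rightarrow> 'a) \<Rightarrow> 'i set \<Rightarrow> bool" where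
  "is_basis M b I \<longleftrightarrow> b \<in> I \<rightarrow> carrier M \<and>
     (\<forall>a\<in>carrier M. \<exists>c :: 'i \<Rightarrow>\<^sub>0 'k. Poly_Mapping.keys c \<subseteq> I \<and>
        a = (\<Oplus>\<^bsub>M\<^esub> i\<in>Poly_Mapping.keys c. Poly_Mapping.lookup c i \<odot>\<^bsub>M\<^esub> b i)) \<and>
     (\<forall>c :: 'i \<Rightarrow>\<^sub>0 'k. Poly_Mapping.keys c \<subseteq> I \<longrightarrow>
        (\<Oplus>\<^bsub>M\<^esub> i\<in>Poly_Mapping.keys c. Poly_Mapping.lookup c i \<odot>\<^bsub>M\<^esub> b i) = \<zero>\<^bsub>M\<^esub> \<longrightarrow> c = 0)"


section \<open>Bracketed words\<close>

text \<open>
  A bracketed word is the list of its prime factors; the monoid operation is concatenation and the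
  breadth is the length.
\<close>

datatype ('x, 'w) bprime = Letter 'x | Bracket 'w "('x, 'w) bprime list"

type_synonym ('x, 'w) bword = "('x, 'w) bprime list"

fun bwords_upto :: "'x set \<Rightarrow> nat \<Rightarrow> ('x, 'w) bword set" where
  "bwords_upto X 0 = lists (Letter ` X)"
| "bwords_upto X (Suc n) = lists (Letter ` X \<union> (\<Union>\<omega>. Bracket \<omega> ` bwords_upto X n))"

definition bwords :: "'x set \<Rightarrow> ('x, 'w) bword set" where
  "bwords X = (\<Union>n. bwords_upto X n)"

text \<open>
  With this instance, the convolution product of \<^theory>\<open>HOL-Library.Poly_Mapping\<close> on
  \<open>('x, 'w) bword \<Rightarrow>\<^sub>0 'k\<close> is the bilinear extension of concatenation.
\<close>

instantiation list :: (type) monoid_add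
begin
definition zero_list :: "'a list" where "zero_list = []"
definition plus_list :: "'a list \<Rightarrow> 'a list \<Rightarrow> 'a list" where "plus_list xs ys = xs @ ys"
instance by standard (simp_all add: zero_list_def plus_list_def)
end

definition monomial :: "'a \<Rightarrow> 'a \<Rightarrow>\<^sub>0 'k::zero_neq_one" where
  "monomial w = Poly_Mapping.single w 1"

definition scale :: "'k::comm_ring_1 \<Rightarrow> ('a \<Rightarrow>\<^sub>0 'k) \<Rightarrow> ('a \<Rightarrow>\<^sub>0 'k)" where
  "scale c f = Poly_Mapping.map ((*) c) f"

definition linear_ext :: "('a \<Rightarrow> 'b) \<Rightarrow> ('a \<Rightarrow>\<^sub>0 'k::comm_ring_1) \<Rightarrow> ('b \<Rightarrow>\<^sub>0 'k)" where
  "linear_ext h f =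
     (\<Sum>w\<in>Poly_Mapping.keys f. Poly_Mapping.single (h w) (Poly_Mapping.lookup f w))"

definition bword_algebra ::
  "'x set \<Rightarrow> ('k::comm_ring_1, ('x, 'w) bword \<Rightarrow>\<^sub>0 'k, 'w) operated_algebra" where
  "bword_algebra X =
     \<lparr>carrier = {f. Poly_Mapping.keys f \<subseteq> bwords X}, monoid.mult = (*), one = 1, ring.zero = 0, add = (+),
      module.smult = scale, oper = (\<lambda>\<omega>. linear_ext (\<lambda>w. [Bracket \<omega> w]))\<rparr>"


subsection \<open>Star words\<close>

text \<open>The letter \<open>None\<close> plays the role of \<open>\<star>\<close>, adjoined to \<open>X\<close>.\<close>

primrec stars_prime :: "('x option, 'w) bprime \<Rightarrow> nat" where
  "stars_prime (Letter x) = (if x = None then 1 else 0)"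
| "stars_prime (Bracket \<omega> u) = sum_list (map stars_prime u)"

definition star_words :: "'x set \<Rightarrow> ('x option, 'w) bword set" where
  "star_words X = {q \<in> bwords (insert None (Some ` X)). sum_list (map stars_prime q) = 1}"

primrec plug_prime :: "('x, 'w) bword \<Rightarrow> ('x option, 'w) bprime \<Rightarrow> ('x, 'w) bword" where
  "plug_prime u (Letter x) = (case x of None \<Rightarrow> u | Some y \<Rightarrow> [Letter y])"
| "plug_prime u (Bracket \<omega> v) = [Bracket \<omega> (concat (map (plug_prime u) v))]"

definition plug :: "('x option, 'w) bword \<Rightarrow> ('x, 'w) bword \<Rightarrow> ('x, 'w) bword" where
  "plug q u = concat (map (plug_prime u) q)"

definition plug_lin ::
  "('x option, 'w) bword \<Rightarrow> (('x, 'w) bword \<Rightarrow>\<^sub>0 'k::comm_ring_1) \<Rightarrow> (('x, 'w) bword \<Rightarrow>\<^sub>0 'k)" where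
  "plug_lin q = linear_ext (plug q)"


section \<open>Monomial orders and Groebner-Shirshov bases\<close>

definition monomial_order :: "'x set \<Rightarrow> ('x, 'w) bword rel \<Rightarrow> bool" where
  "monomial_order X ord \<longleftrightarrow> well_order_on (bwords X) ord \<and>
     (\<forall>u\<in>bwords X. \<forall>v\<in>bwords X. \<forall>q\<in>star_words X.
        (u, v) \<in> ord - Id \<longrightarrow> (plug q u, plug q v) \<in> ord - Id)"

definition lead :: "'a rel \<Rightarrow> ('a \<Rightarrow>\<^sub>0 'k::comm_ring_1) \<Rightarrow> 'a" where
  "lead ord f =
     (THE w. w \<in> Poly_Mapping.keys f \<and> (\<forall>v\<in>Poly_Mapping.keys f. (v, w) \<in> ord))"

definition monic :: "'a rel \<Rightarrow> ('a \<Rightarrow>\<^sub>0 'k::comm_ring_1) \<Rightarrow> bool" where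
  "monic ord f \<longleftrightarrow> f \<noteq> 0 \<and> Poly_Mapping.lookup f (lead ord f) = 1"

definition intersection_composition ::
  "'x set \<Rightarrow> ('x, 'w) bword rel \<Rightarrow> (('x, 'w) bword \<Rightarrow>\<^sub>0 'k::comm_ring_1) \<Rightarrow>
    (('x, 'w) bword \<Rightarrow>\<^sub>0 'k) \<Rightarrow> ('x, 'w) bword \<Rightarrow> (('x, 'w) bword \<Rightarrow>\<^sub>0 'k) \<Rightarrow> bool" where
  "intersection_composition X ord f g w h \<longleftrightarrow> f \<noteq> g \<and> w \<in> bwords X \<and>
     (\<exists>u\<in>bwords X. \<exists>v\<in>bwords X.
        w = lead ord f @ u \<and> w = v @ lead ord g \<and>
        max (length (lead ord f)) (length (lead ord g)) < length w \<and>
        length w < length (lead ord f) + length (lead ord g) \<and>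
        h = f * monomial u - monomial v * g)"

definition including_composition ::
  "'x set \<Rightarrow> ('x, 'w) bword rel \<Rightarrow> (('x, 'w) bword \<Rightarrow>\<^sub>0 'k::comm_ring_1) \<Rightarrow>
    (('x, 'w) bword \<Rightarrow>\<^sub>0 'k) \<Rightarrow> ('x, 'w) bword \<Rightarrow> (('x, 'w) bword \<Rightarrow>\<^sub>0 'k) \<Rightarrow> bool" where
  "including_composition X ord f g w h \<longleftrightarrow> f \<noteq> g \<and>
     (\<exists>q\<in>star_words X. w = lead ord f \<and> w = plug q (lead ord g) \<and> h = f - plug_lin q g)"

definition trivial_mod ::
  "'x set \<Rightarrow> ('x, 'w) bword rel \<Rightarrow> (('x, 'w) bword \<Rightarrow>\<^sub>0 'k::comm_ring_1) set \<Rightarrow>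
    ('x, 'w) bword \<Rightarrow> (('x, 'w) bword \<Rightarrow>\<^sub>0 'k) \<Rightarrow> bool" where
  "trivial_mod X ord S w h \<longleftrightarrow>
     (\<exists>(n::nat) c q s. h = (\<Sum>i<n. scale (c i) (plug_lin (q i) (s i))) \<and>
        (\<forall>i<n. c i \<noteq> 0 \<and> q i \<in> star_words X \<and> s i \<in> S \<and>
               (plug (q i) (lead ord (s i)), w) \<in> ord - Id))"

definition groebner_shirshov_basis ::
  "'x set \<Rightarrow> ('x, 'w) bword rel \<Rightarrow> (('x, 'w) bword \<Rightarrow>\<^sub>0 'k::comm_ring_1) set \<Rightarrow> bool" where
  "groebner_shirshov_basis X ord S \<longleftrightarrow>
     (\<forall>f\<in>S. Poly_Mapping.keys f \<subseteq> bwords X \<and> monic ord f) \<and>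
     (\<forall>f\<in>S. \<forall>g\<in>S. \<forall>w h.
        intersection_composition X ord f g w h \<or> including_composition X ord f g w h \<longrightarrow>
        trivial_mod X ord S w h)"

definition Irr ::
  "'x set \<Rightarrow> ('x, 'w) bword rel \<Rightarrow> (('x, 'w) bword \<Rightarrow>\<^sub>0 'k::comm_ring_1) set \<Rightarrow>
    ('x, 'w) bword set" where
  "Irr X ord S = {w \<in> bwords X. \<forall>q\<in>star_words X. \<forall>s\<in>S. w \<noteq> plug q (lead ord s)}"


section \<open>The order \<open>\<le>\<^sub>d\<^sub>b\<close>\<close>

primrec deg_prime :: "('x, 'w) bprime \<Rightarrow> nat" where
  "deg_prime (Letter x) = 1"
| "deg_prime (Bracket \<omega> u) = Suc (sum_list (map deg_prime u))"

definition deg_word :: "('x, 'w) bword \<Rightarrow> nat" where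
  "deg_word u = sum_list (map deg_prime u)"

text \<open>
  The strict part of the order; \<open>rX\<close> and \<open>rW\<close> are the (reflexive) well orders on letters and on
  operators. The recursion passes from words to their prime factors and from brackets to their
  contents, hence is well founded, and the inductive definition agrees with the recursive one.
\<close>

inductive db_less :: "'x rel \<Rightarrow> 'w rel \<Rightarrow> ('x, 'w) bword \<Rightarrow> ('x, 'w) bword \<Rightarrow> bool"
  and db_less_prime :: "'x rel \<Rightarrow> 'w rel \<Rightarrow> ('x, 'w) bprime \<Rightarrow> ('x, 'w) bprime \<Rightarrow> bool"
  for rX :: "'x rel" and rW :: "'w rel" where
  word_deg: "deg_word u < deg_word v \<Longrightarrow> db_less rX rW u v"
| word_breadth: "deg_word u = deg_word v \<Longrightarrow> length u < length v \<Longrightarrow> db_less rX rW u v"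
| word_lex: "deg_word u = deg_word v \<Longrightarrow> length u = length v \<Longrightarrow>
    u = p @ a # s \<Longrightarrow> v = p @ b # t \<Longrightarrow> db_less_prime rX rW a b \<Longrightarrow> db_less rX rW u v"
| prime_deg: "deg_prime a < deg_prime b \<Longrightarrow> db_less_prime rX rW a b"
| prime_letters: "(x, y) \<in> rX - Id \<Longrightarrow> db_less_prime rX rW (Letter x) (Letter y)"
| prime_letter_bracket: "deg_prime (Letter x :: ('x, 'w) bprime) = deg_prime (Bracket \<beta> v) \<Longrightarrow>
    db_less_prime rX rW (Letter x) (Bracket \<beta> v)"
| prime_operators: "deg_prime (Bracket \<alpha> u) = deg_prime (Bracket \<beta> v) \<Longrightarrow>
    (\<alpha>, \<beta>) \<in> rW - Id \<Longrightarrow> db_less_prime rX rW (Bracket \<alpha> u) (Bracket \<beta> v)"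
| prime_brackets: "deg_prime (Bracket \<alpha> u) = deg_prime (Bracket \<alpha> v) \<Longrightarrow>
    db_less rX rW u v \<Longrightarrow> db_less_prime rX rW (Bracket \<alpha> u) (Bracket \<alpha> v)"

definition db_order :: "'x set \<Rightarrow> 'x rel \<Rightarrow> 'w rel \<Rightarrow> ('x, 'w) bword rel" where
  "db_order X rX rW =
     {(u, v). u \<in> bwords X \<and> v \<in> bwords X \<and> (u = v \<or> db_less rX rW u v)}"


section \<open>The Rota-Baxter relations\<close>

definition RB_relations ::
  "'w four_ops \<Rightarrow> 'x set \<Rightarrow> (('x, 'w) bword \<Rightarrow>\<^sub>0 'k::comm_ring_1) set" where
  "RB_relations Om X =
     {monomial ([Bracket \<alpha> u] @ [Bracket \<beta> v])
      - monomial [Bracket (\<alpha> \<^bold>\<rightarrow>\<^bsub>Om\<^esub> \<beta>) ([Bracket (\<alpha> \<^bold>\<rhd>\<^bsub>Om\<^esub> \<beta>) u] @ v)]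
      - monomial [Bracket (\<alpha> \<^bold>\<leftarrow>\<^bsub>Om\<^esub> \<beta>) (u @ [Bracket (\<alpha> \<^bold>\<lhd>\<^bsub>Om\<^esub> \<beta>) v])]
      | u v \<alpha> \<beta>. u \<in> bwords X \<and> v \<in> bwords X}"

end

theory Submission
  imports Defs
begin

text \<open>
  On the span of all bracketed words, the Rota-Baxter relation read from left to right defines a
  product \<open>\<lfloor>a\<rfloor>\<^sub>\<alpha> \<diamondop> \<lfloor>b\<rfloor>\<^sub>\<beta>\<close> by recursion on the degree; it replaces concatenation where two brackets
  meet. The fifteen axioms of an extended diassociative semigroup make \<open>\<diamondop>\<close> associative, so this span
  becomes an \<open>\<Omega>\<close>-Rota-Baxter algebra. Evaluating bracketed words in it kills the ideal \<open>I\<close> of the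
  relations and fixes every irreducible word, hence no nonzero combination of irreducible words
  lies in \<open>I\<close>. Conversely every word reduces modulo the relations, without exceeding
  itself in the monomial order, to a combination of irreducible words. A composition with
  ambiguity \<open>w\<close> lies in \<open>I\<close> and has all its monomials below \<open>w\<close>; its reduced form lies in \<open>I\<close> and is
  therefore zero, which is triviality modulo \<open>w\<close>. Thus no composition has to be computed.
\<close>

section \<open>Linear extensions\<close>

text \<open>The three words in a relation have equal degree, so breadth decides: the product of two
  brackets has breadth 2 and leads, the other two words have breadth 1. Irreducible words are
  therefore those without adjacent brackets at any depth. All leading coefficients are 1, which lets
  reduction work over a ring with zero divisors.

  The usual route checks the compositions first and deduces independence from the diamond lemma.
  Here the order is reversed, so the whole burden falls on associativity of \<diamondop>, and there
  on a product of three brackets. Both ways of multiplying expand into four terms, but these do not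
  match one to one: a term on one side may equal the sum of two on the other. The axioms say exactly
  that the labels of the matched terms agree.

  The product is defined on all words, reduced or not, so closure is automatic; reducedness enters
  only when evaluation is shown to fix reduced words. Both kinds of composition are differences of
  two substitution instances of relations with the same leading word, so one argument serves
  both.\<close>

abbreviation "keys \<equiv> Poly_Mapping.keys"
abbreviation "lookup \<equiv> Poly_Mapping.lookup"

lemma lookup_scale [simp]: "lookup (scale c f) w = c * lookup f w"
  unfolding scale_def by (simp add: Poly_Mapping.map.rep_eq when_def)

lemma scale_simps [simp]:
  "scale c 0 = 0" "scale 0 f = 0" "scale 1 f = f"
  by (rule poly_mapping_eqI, simp)+

lemma scale_add: "scale c (f + g) = scale c f + scale c g"
  by (rule poly_mapping_eqI) (simp add: lookup_add algebra_simps)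

lemma scale_add_left: "scale (c + d) f = scale c f + scale d f"
  by (rule poly_mapping_eqI) (simp add: lookup_add algebra_simps)

lemma scale_diff: "scale c (f - g) = scale c f - scale c g"
  by (rule poly_mapping_eqI) (simp add: lookup_minus algebra_simps)

lemma scale_uminus: "scale (- 1) f = - f"
  by (rule poly_mapping_eqI) simp

lemma scale_scale: "scale c (scale d f) = scale (c * d) f"
  by (rule poly_mapping_eqI) (simp add: mult.assoc)

lemma scale_sum: "scale c (\<Sum>i\<in>A. f i) = (\<Sum>i\<in>A. scale c (f i))"
  by (induction A rule: infinite_finite_induct) (simp_all add: scale_add)

lemma keys_scale: "keys (scale c f) \<subseteq> keys f"
  by (auto simp: in_keys_iff)

lemma single_conv_scale: "Poly_Mapping.single w c = scale c (monomial w)"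
  by (rule poly_mapping_eqI) (simp add: monomial_def lookup_single when_def)

lemma scale_single: "scale c (Poly_Mapping.single w d) = Poly_Mapping.single w (c * d)"
  by (rule poly_mapping_eqI) (simp add: lookup_single when_def)

lemma lookup_monomial: "lookup (monomial w) v = (if v = w then 1 else 0)"
  by (simp add: monomial_def lookup_single when_def)

lemma keys_monomial [simp]: "keys (monomial w :: _ \<Rightarrow>\<^sub>0 'k::zero_neq_one) = {w}"
  by (simp add: monomial_def)

lemma sum_monomials: "(\<Sum>w\<in>keys f. scale (lookup f w) (monomial w)) = f"
proof (rule poly_mapping_eqI)
  fix v
  have "(\<Sum>w\<in>keys f. lookup f w * (if v = w then 1 else 0)) = (\<Sum>w\<in>keys f. if v = w then lookup f w else 0)"
    by (rule sum.cong) auto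
  then show "lookup (\<Sum>w\<in>keys f. scale (lookup f w) (monomial w)) v = lookup f v"
    by (simp add: lookup_sum lookup_monomial in_keys_iff)
qed

text \<open>Reduces identities between linear maps to monomials. The partial sums \<open>F K\<close>
  over subsets of the support stay supported in \<open>W\<close>, so the additive case may assume
  both supports inside \<open>W\<close>, as closure arguments require.\<close>

lemma linear_induct [consumes 1, case_names zero add monomial]:
  fixes f :: "'a \<Rightarrow>\<^sub>0 'k::comm_ring_1"
  assumes keys: "keys f \<subseteq> W"
    and zero: "P 0"
    and add: "\<And>f g. keys f \<subseteq> W \<Longrightarrow> keys g \<subseteq> W \<Longrightarrow> P f \<Longrightarrow> P g \<Longrightarrow> P (f + g)"
    and monomial: "\<And>c w. w \<in> W \<Longrightarrow> P (scale c (monomial w))"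
  shows "P f"
proof -
  define F where "F K = (\<Sum>w\<in>K. scale (lookup f w) (monomial w))" for K
  have "keys (F K) \<subseteq> W \<and> P (F K)" if "finite K" "K \<subseteq> W" for K
    using that
  proof (induction K)
    case empty
    show ?case by (simp add: F_def zero)
  next
    case (insert w K)
    have "keys (scale (lookup f w) (monomial w)) \<subseteq> W"
      using insert.prems keys_scale[of _ "monomial w"] by fastforce
    moreover from this insert have "P (scale (lookup f w) (monomial w) + F K)"
      by (intro add monomial) auto
    ultimately show ?case
      using insert keys_add[of "scale (lookup f w) (monomial w)" "F K"] by (auto simp: F_def)
  qed
  from this[of "keys f"] show ?thesis
    using keys by (simp add: F_def sum_monomials)
qed

lemma monomial_mult: "monomial u * monomial v = (monomial (u + v) :: 'a::monoid_add \<Rightarrow>\<^sub>0 'k::comm_ring_1)"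
  by (simp add: monomial_def mult_single)

lemma scale_mult_left: "scale c f * g = scale c (f * g :: 'a::monoid_add \<Rightarrow>\<^sub>0 'k::comm_ring_1)"
proof -
  \<comment> \<open>Scaling is multiplication by a constant placed at the neutral monomial, which
    turns the claim into associativity.\<close>
  have *: "scale c (h :: 'a \<Rightarrow>\<^sub>0 'k) = Poly_Mapping.single 0 c * h" for h
    by (induction h rule: linear_induct[OF subset_UNIV])
      (simp_all add: scale_add distrib_left scale_single mult_single flip: single_conv_scale)
  show ?thesis by (simp add: * mult.assoc)
qed

lemma scale_mult_right: "f * scale c g = scale c (f * g :: 'a::monoid_add \<Rightarrow>\<^sub>0 'k::comm_ring_1)"
proof -
  \<comment> \<open>The constant may also stand on the right because the coefficient ring is
    commutative.\<close>
  have *: "scale c (h :: 'a \<Rightarrow>\<^sub>0 'k) = h * Poly_Mapping.single 0 c" for h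
    by (induction h rule: linear_induct[OF subset_UNIV])
      (simp_all add: scale_add distrib_right scale_single mult_single mult.commute flip: single_conv_scale)
  show ?thesis by (simp add: * mult.assoc)
qed

text \<open>Unlike in \<open>linear_ext\<close>, the values of \<open>h\<close> are arbitrary
  vectors. The product \<open>dprod\<close> needs this, since the product of two words is in general
  a sum of words.\<close>

definition lin :: "('a \<Rightarrow> 'b \<Rightarrow>\<^sub>0 'k::comm_ring_1) \<Rightarrow> ('a \<Rightarrow>\<^sub>0 'k) \<Rightarrow> 'b \<Rightarrow>\<^sub>0 'k" where
  "lin h f = (\<Sum>w\<in>keys f. scale (lookup f w) (h w))"

lemma lin_superset:
  assumes "finite K" "keys f \<subseteq> K"
  shows "lin h f = (\<Sum>w\<in>K. scale (lookup f w) (h w))"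
  unfolding lin_def using assms
  by (intro sum.mono_neutral_left) (auto simp: in_keys_iff)

lemma lin_add: "lin h (f + g) = lin h f + lin h g"
proof -
  have "keys (f + g) \<subseteq> keys f \<union> keys g" by (rule keys_add)
  then show ?thesis
    by (simp add: lin_superset[of "keys f \<union> keys g"] lookup_add scale_add_left sum.distrib)
qed

lemma lin_zero [simp]: "lin h 0 = 0"
  by (simp add: lin_def)

lemma lin_monomial [simp]: "lin h (monomial w) = h w"
  by (simp add: lin_def lookup_monomial)

lemma lin_scale: "lin h (scale c f) = scale c (lin h f)"
  unfolding lin_superset[OF finite_keys keys_scale] by (simp add: lin_def scale_sum scale_scale)

lemma lin_add_fun: "lin (\<lambda>w. h w + h' w) f = lin h f + lin h' f"
  by (simp add: lin_def scale_add sum.distrib)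

lemma lin_scale_fun: "lin (\<lambda>w. scale c (h w)) f = scale c (lin h f)"
  by (simp add: lin_def scale_sum scale_scale mult.commute)

lemma lin_zero_fun [simp]: "lin (\<lambda>w. 0) f = 0"
  by (simp add: lin_def)

lemma keys_lin: "keys (lin h f) \<subseteq> (\<Union>w\<in>keys f. keys (h w))"
proof -
  have "keys (scale (lookup f w) (h w)) \<subseteq> keys (h w)" for w by (rule keys_scale)
  then show ?thesis
    unfolding lin_def using keys_sum[of "\<lambda>w. scale (lookup f w) (h w)" "keys f"] by blast
qed

lemma linear_ext_conv_lin: "linear_ext h f = lin (\<lambda>w. monomial (h w)) f"
  by (simp add: linear_ext_def lin_def single_conv_scale)

lemma linear_ext_add: "linear_ext h (f + g) = linear_ext h f + linear_ext h g"
  by (simp add: linear_ext_conv_lin lin_add)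

lemma linear_ext_scale: "linear_ext h (scale c f) = scale c (linear_ext h f)"
  by (simp add: linear_ext_conv_lin lin_scale)

lemma linear_ext_zero [simp]: "linear_ext h 0 = 0"
  by (simp add: linear_ext_conv_lin)

lemma linear_ext_monomial [simp]: "linear_ext h (monomial w) = monomial (h w)"
  by (simp add: linear_ext_conv_lin)

lemma keys_linear_ext: "keys (linear_ext h f) \<subseteq> h ` keys f"
  unfolding linear_ext_conv_lin using keys_lin[of "\<lambda>w. monomial (h w)" f] by auto

text \<open>An injective relabelling merges no monomials. With \<open>h\<close> a substitution into
  a fixed star word, this preserves the leading coefficient 1. Inserting \<open>w\<close> covers
  words outside the support, where both coefficients vanish.\<close>

lemma lookup_linear_ext_inj:
  assumes "inj_on h (insert w (keys f))"
  shows "lookup (linear_ext h f) (h w) = lookup f w"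
proof -
  have "lookup (linear_ext h f) (h w) = (\<Sum>v\<in>keys f. if v = w then lookup f v else 0)"
    unfolding linear_ext_conv_lin lin_def lookup_sum
    using assms by (intro sum.cong) (auto simp: lookup_monomial inj_on_def)
  then show ?thesis by (simp add: in_keys_iff)
qed

section \<open>Bracketed words and star words\<close>

lemma deg_word_simps [simp]:
  "deg_word [] = 0" "deg_word (p # w) = deg_prime p + deg_word w"
  "deg_word (u @ v) = deg_word u + deg_word v"
  by (simp_all add: deg_word_def)

lemma deg_prime_Bracket [simp]: "deg_prime (Bracket \<omega> u) = Suc (deg_word u)"
  by (simp add: deg_word_def)

declare deg_prime.simps(2) [simp del]

lemma deg_prime_pos [simp]: "0 < deg_prime p"
  by (cases p) auto

text \<open>Content and tail of a word starting with a bracket both have smaller degree than the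
  word. One predicate on words thus suffices, instead of simultaneous predicates for words and
  primes as in the nested datatype.\<close>

lemma bword_induct [case_names Nil Letter Bracket]:
  assumes "P []" "\<And>x w. P w \<Longrightarrow> P (Letter x # w)" "\<And>\<omega> u w. P u \<Longrightarrow> P w \<Longrightarrow> P (Bracket \<omega> u # w)"
  shows "P w"
proof (induction w rule: measure_induct_rule[where f = deg_word])
  case (less w)
  show ?case
  proof (cases w)
    case Nil
    then show ?thesis using assms(1) by simp
  next
    case (Cons p v)
    with less assms show ?thesis by (cases p) auto
  qed
qed

lemma bwords_upto_Suc: "(bwords_upto X n :: ('x, 'w) bword set) \<subseteq> bwords_upto X (Suc n)"
proof (induction n)
  case 0
  show ?case unfolding bwords_upto.simps by (rule lists_mono) simp
next
  case (Suc n)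
  then have "Letter ` X \<union> (\<Union>\<omega> :: 'w. Bracket \<omega> ` bwords_upto X n)
    \<subseteq> Letter ` X \<union> (\<Union>\<omega>. Bracket \<omega> ` bwords_upto X (Suc n))"
    by (intro Un_mono UN_mono image_mono order_refl)
  then show ?case
    using lists_mono unfolding bwords_upto.simps(2) by metis
qed

lemma bwords_upto_mono: "n \<le> m \<Longrightarrow> bwords_upto X n \<subseteq> bwords_upto X m"
  using lift_Suc_mono_le[of "bwords_upto X"] bwords_upto_Suc by metis

lemma bwords_Nil [simp]: "[] \<in> bwords X"
  unfolding bwords_def by (auto intro: exI[of _ 0])

lemma bwords_Letter [simp]: "Letter x # w \<in> bwords X \<longleftrightarrow> x \<in> X \<and> w \<in> bwords X"
proof -
  have "Letter x # w \<in> bwords_upto X n \<longleftrightarrow> x \<in> X \<and> w \<in> bwords_upto X n" for n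
    by (cases n) auto
  then show ?thesis by (auto simp: bwords_def)
qed

text \<open>Content and tail may first appear at different depths, so both are lifted to the larger
  one. Together with the rules for letters and concatenation this turns the union over depths into a
  structural test.\<close>

lemma bwords_Bracket [simp]: "Bracket \<omega> u # w \<in> bwords X \<longleftrightarrow> u \<in> bwords X \<and> w \<in> bwords X"
proof
  assume "Bracket \<omega> u # w \<in> bwords X"
  then obtain n where n: "Bracket \<omega> u # w \<in> bwords_upto X n" by (auto simp: bwords_def)
  then obtain m where "n = Suc m" by (cases n) auto
  with n have "u \<in> bwords_upto X m" "w \<in> bwords_upto X (Suc m)" by auto
  then show "u \<in> bwords X \<and> w \<in> bwords X" unfolding bwords_def by blast
next
  assume "u \<in> bwords X \<and> w \<in> bwords X"
  then obtain n m where "u \<in> bwords_upto X n" "w \<in> bwords_upto X m" by (auto simp: bwords_def)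
  then have "u \<in> bwords_upto X (max n m)" "w \<in> bwords_upto X (Suc (max n m))"
    by (meson bwords_upto_mono le_SucI max.cobounded1 max.cobounded2 subsetD)+
  then have "Bracket \<omega> u # w \<in> bwords_upto X (Suc (max n m))" by auto
  then show "Bracket \<omega> u # w \<in> bwords X" unfolding bwords_def by blast
qed

lemma bwords_append [simp]: "u @ v \<in> bwords X \<longleftrightarrow> u \<in> bwords X \<and> v \<in> bwords X"
  by (induction u rule: bword_induct) auto

lemma bwords_plus [simp]: "u + v \<in> bwords X \<longleftrightarrow> u \<in> bwords X \<and> v \<in> bwords X"
  by (simp add: plus_list_def)

lemma bwords_induct [consumes 1, case_names Nil Letter Bracket]:
  assumes "w \<in> bwords X" "P []"
    "\<And>x w. x \<in> X \<Longrightarrow> w \<in> bwords X \<Longrightarrow> P w \<Longrightarrow> P (Letter x # w)"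
    "\<And>\<omega> u w. u \<in> bwords X \<Longrightarrow> w \<in> bwords X \<Longrightarrow> P u \<Longrightarrow> P w \<Longrightarrow> P (Bracket \<omega> u # w)"
  shows "P w"
  using assms(1) by (induction w rule: bword_induct) (auto intro: assms)

section \<open>Star words as contexts around a single star\<close>

definition emb :: "('x, 'w) bword \<Rightarrow> ('x option, 'w) bword" where
  "emb = map (map_bprime Some id)"

lemma emb_simps [simp]:
  "emb [] = []"
  "emb (Letter x # w) = Letter (Some x) # emb w"
  "emb (Bracket \<omega> u # w) = Bracket \<omega> (emb u) # emb w"
  "emb (u @ v) = emb u @ emb v"
  by (simp_all add: emb_def)

lemma plug_simps [simp]:
  "plug [] u = []"
  "plug (Letter None # q) u = u @ plug q u"
  "plug (Letter (Some x) # q) u = Letter x # plug q u"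
  "plug (Bracket \<omega> r # q) u = Bracket \<omega> (plug r u) # plug q u"
  "plug (q @ r) u = plug q u @ plug r u"
  by (simp_all add: plug_def)

definition stars :: "('x option, 'w) bword \<Rightarrow> nat" where
  "stars q = sum_list (map stars_prime q)"

lemma stars_simps [simp]:
  "stars [] = 0"
  "stars (Letter None # q) = Suc (stars q)"
  "stars (Letter (Some x) # q) = stars q"
  "stars (Bracket \<omega> r # q) = stars r + stars q"
  "stars (q @ r) = stars q + stars r"
  by (simp_all add: stars_def)

lemma star_words_iff: "q \<in> star_words X \<longleftrightarrow> q \<in> bwords (insert None (Some ` X)) \<and> stars q = 1"
  by (simp add: star_words_def stars_def)

lemma plug_emb [simp]: "plug (emb w) u = w"
  by (induction w rule: bword_induct) auto

lemma stars_emb [simp]: "stars (emb w) = 0"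
  by (induction w rule: bword_induct) auto

lemma emb_in_bwords [simp]: "emb w \<in> bwords (insert None (Some ` X)) \<longleftrightarrow> w \<in> bwords X"
  by (induction w rule: bword_induct) auto

lemma stars_eq_0E:
  assumes "stars q = 0" "q \<in> bwords (insert None (Some ` X))"
  obtains w where "w \<in> bwords X" "q = emb w"
proof -
  have "\<exists>w\<in>bwords X. q = emb w"
    using assms
  proof (induction q rule: bword_induct)
    case Nil
    show ?case by (rule bexI[of _ "[]"]) auto
  next
    case (Letter y q)
    then obtain x w where "y = Some x" "x \<in> X" "w \<in> bwords X" "q = emb w" by (cases y) auto
    then show ?case by (intro bexI[of _ "Letter x # w"]) auto
  next
    case (Bracket \<omega> r q)
    then obtain v w where "v \<in> bwords X" "r = emb v" "w \<in> bwords X" "q = emb w" by auto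
    then show ?case by (intro bexI[of _ "Bracket \<omega> v # w"]) auto
  qed
  with that show ?thesis by blast
qed

lemma star_words_starI [intro, simp]:
  "l \<in> bwords X \<Longrightarrow> r \<in> bwords X \<Longrightarrow> emb l @ Letter None # emb r \<in> star_words X"
  by (simp add: star_words_iff)

text \<open>The only star is either a prime factor itself or lies inside exactly one top-level
  bracket; whatever surrounds it is star-free and hence of the form \<open>emb w\<close>.\<close>

lemma star_words_cases [consumes 1, case_names star Bracket]:
  assumes "q \<in> star_words X"
  obtains l r where "l \<in> bwords X" "r \<in> bwords X" "q = emb l @ Letter None # emb r"
  | l r \<omega> p where "l \<in> bwords X" "r \<in> bwords X" "p \<in> star_words X" "q = emb l @ Bracket \<omega> p # emb r"
proof -
  \<comment> \<open>\<open>D\<close> is the claimed alternative. A star-free prime put in front of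
    the word is absorbed into \<open>l\<close>, so \<open>D\<close> propagates from right to
    left.\<close>
  define D where "D q \<longleftrightarrow> (\<exists>l\<in>bwords X. \<exists>r\<in>bwords X. q = emb l @ Letter None # emb r \<or>
    (\<exists>\<omega>. \<exists>p\<in>star_words X. q = emb l @ Bracket \<omega> p # emb r))" for q :: "('a option, 'b) bword"
  have step: "D (emb [a] @ q)" if "D q" "[a] \<in> bwords X" for a q
  proof -
    from that(1) obtain l r where lr: "l \<in> bwords X" "r \<in> bwords X" "q = emb l @ Letter None # emb r \<or>
      (\<exists>\<omega>. \<exists>p\<in>star_words X. q = emb l @ Bracket \<omega> p # emb r)" unfolding D_def by blast
    have "emb ([a] @ l) = emb [a] @ emb l" by (rule emb_simps)
    moreover have "[a] @ l \<in> bwords X" using lr that by (simp only: bwords_append)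
    ultimately show ?thesis unfolding D_def using lr
      by (intro bexI[of _ "[a] @ l"] bexI[of _ r]) (auto simp del: append_Cons)
  qed
  have "D q"
    using assms
  proof (induction q)
    case Nil
    then show ?case by (simp add: star_words_iff)
  next
    case (Cons a q)
    consider (star) "a = Letter None" | (letter) x where "a = Letter (Some x)" | (Bracket) \<omega> p where "a = Bracket \<omega> p"
      by (metis bprime.exhaust not_None_eq)
    then show ?case
    proof cases
      case star
      with Cons.prems have "stars q = 0" "q \<in> bwords (insert None (Some ` X))" by (auto simp: star_words_iff)
      then obtain r where "r \<in> bwords X" "q = emb r" by (rule stars_eq_0E)
      with star show ?thesis unfolding D_def by (intro bexI[of _ "[]"] bexI[of _ r]) auto
    next
      case letter
      with Cons show ?thesis
        using step[of q "Letter x"] by (auto simp: star_words_iff)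
    next
      case Bracket
      consider "stars p = 0" "stars q = 1" | "stars p = 1" "stars q = 0"
        using Cons.prems Bracket by (auto simp: star_words_iff add_is_1)
      then show ?thesis
      proof cases
        case 1
        with Cons.prems Bracket obtain u where "u \<in> bwords X" "p = emb u"
          by (auto simp: star_words_iff elim: stars_eq_0E)
        with 1 Bracket Cons show ?thesis
          using step[of q "Bracket \<omega> u"] by (auto simp: star_words_iff)
      next
        case 2
        with Cons.prems Bracket obtain r where "r \<in> bwords X" "q = emb r"
          by (auto simp: star_words_iff elim: stars_eq_0E)
        moreover have "p \<in> star_words X" using 2 Cons.prems Bracket by (auto simp: star_words_iff)
        ultimately show ?thesis
          unfolding D_def using Bracket by (intro bexI[of _ "[]"] bexI[of _ r]) auto
      qed
    qed
  qed
  then show ?thesis unfolding D_def using that by blast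
qed

text \<open>Every context arises from the star by alternately multiplying on both sides and
  bracketing. Hence whatever respects these two operations respects substitution; the order,
  operated ideals and injectivity of \<open>plug q\<close> are all treated this way.\<close>

lemma star_words_induct [consumes 1, case_names star Bracket]:
  assumes "q \<in> star_words X"
    and "\<And>l r. l \<in> bwords X \<Longrightarrow> r \<in> bwords X \<Longrightarrow> P (emb l @ Letter None # emb r)"
    and "\<And>l r \<omega> q. l \<in> bwords X \<Longrightarrow> r \<in> bwords X \<Longrightarrow> q \<in> star_words X \<Longrightarrow> P q \<Longrightarrow>
      P (emb l @ Bracket \<omega> q # emb r)"
  shows "P q"
  using assms(1)
proof (induction q rule: measure_induct_rule[where f = deg_word])
  case (less q)
  from less.prems show ?case
    by (cases rule: star_words_cases) (simp_all add: assms(2,3) less.IH)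
qed

lemma plug_in_bwords: "q \<in> star_words X \<Longrightarrow> u \<in> bwords X \<Longrightarrow> plug q u \<in> bwords X"
  by (induction rule: star_words_induct) auto

section \<open>The order is a monomial order\<close>

text \<open>Breadth followed by lexicographic comparison is \<open>lenlex\<close> over the order on
  primes, for which preservation of well-foundedness is known.\<close>

lemma db_less_iff:
  "db_less rX rW u v \<longleftrightarrow> deg_word u < deg_word v \<or>
     deg_word u = deg_word v \<and> (u, v) \<in> lenlex {(a, b). db_less_prime rX rW a b}"
  by (subst db_less.simps) (auto simp: lenlex_conv lex_conv)

lemma lex_appendI: "length s = length t \<Longrightarrow> (a, b) \<in> r \<Longrightarrow> (p @ a # s, p @ b # t) \<in> lex r"
  unfolding lex_conv by auto

text \<open>The orders on words and primes refer to each other, so neither is well founded before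
  the other. A degree bound breaks the circle: factors of a word of degree at most \<open>n\<close>
  are primes of degree at most \<open>n\<close>, and a bracket of degree at most
  \<open>Suc n\<close> has content of degree at most \<open>n\<close>.\<close>

lemma wf_db_less_upto_aux:
  assumes "wf {(a, b). db_less_prime rX rW a b \<and> deg_prime b \<le> n}" (is "wf ?P")
  shows "wf {(u, v). db_less rX rW u v \<and> deg_word v \<le> n}" (is "wf ?W")
proof (rule wf_subset)
  show "wf (inv_image (less_than <*lex*> lenlex ?P) (\<lambda>u. (deg_word u, u)))"
    using assms by (intro wf_inv_image wf_lex_prod wf_less_than wf_lenlex)
  show "?W \<subseteq> inv_image (less_than <*lex*> lenlex ?P) (\<lambda>u. (deg_word u, u))"
  proof clarify
    fix u v assume uv: "db_less rX rW u v" "deg_word v \<le> n"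
    then consider "deg_word u < deg_word v"
      | "deg_word u = deg_word v" "length u < length v"
      | p a s b t where "deg_word u = deg_word v" "length u = length v"
          "u = p @ a # s" "v = p @ b # t" "db_less_prime rX rW a b"
      by (auto simp: db_less_iff lenlex_conv lex_conv)
    \<comment> \<open>In the lexicographic case \<open>b\<close> is a factor of \<open>v\<close>, so
      its degree is bounded by \<open>n\<close> as well.\<close>
    then show "(u, v) \<in> inv_image (less_than <*lex*> lenlex ?P) (\<lambda>u. (deg_word u, u))"
      using uv(2) by cases (auto simp: lenlex_conv intro!: lex_appendI)
  qed
qed

lemma wf_db_less_prime_upto:
  fixes rX :: "'x rel" and rW :: "'w rel"
  assumes "wf (rX - Id)" "wf (rW - Id)"
  shows "wf {(a, b). db_less_prime rX rW a b \<and> deg_prime b \<le> n}"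
proof (induction n)
  case 0
  have "{(a, b). db_less_prime rX rW a b \<and> deg_prime b \<le> 0} = {}"
  proof -
    have "\<not> deg_prime b \<le> 0" for b :: "('x, 'w) bprime"
      using deg_prime_pos[of b] by linarith
    then show ?thesis by blast
  qed
  then show ?case by (simp only:) simp
next
  case (Suc n)
  let ?W = "{(u, v). db_less rX rW u v \<and> deg_word v \<le> n}"
  let ?R = "less_than <*lex*> less_than <*lex*> (rX - Id) <*lex*> (rW - Id) <*lex*> ?W"
  \<comment> \<open>The slots are degree, kind (letters before brackets), letter, operator, content.
    The \<open>undefined\<close> entries are equal for two primes of the same kind, so the
    comparison passes over them; primes of different kinds are already separated by the second
    slot.\<close>
  let ?f = "\<lambda>a. case a of Letter x \<Rightarrow> (1, 0, x, undefined, []) | Bracket \<omega> u \<Rightarrow> (deg_prime a, Suc 0, undefined, \<omega>, u)"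
  show ?case
  proof (rule wf_subset)
    show "wf (inv_image ?R ?f)"
      using assms Suc by (intro wf_inv_image wf_lex_prod wf_less_than wf_db_less_upto_aux)
    show "{(a, b). db_less_prime rX rW a b \<and> deg_prime b \<le> Suc n} \<subseteq> inv_image ?R ?f"
    proof clarify
      fix a b :: "('x, 'w) bprime"
      assume "db_less_prime rX rW a b" "deg_prime b \<le> Suc n"
      then show "(a, b) \<in> inv_image ?R ?f"
        by (cases rule: db_less_prime.cases) (auto split: bprime.splits)
    qed
  qed
qed

text \<open>A predecessor never has larger degree. An element minimal among those members of
  \<open>Q\<close> whose degree is at most that of some \<open>u\<close> in \<open>Q\<close> is
  therefore minimal in all of \<open>Q\<close>.\<close>

lemma wf_db_less:
  assumes "wf (rX - Id)" "wf (rW - Id)"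
  shows "wf {(u, v). db_less rX rW u v}"
proof (rule wfI_min)
  fix u :: "('a, 'b) bword" and Q
  assume "u \<in> Q"
  let ?W = "{(v, w). db_less rX rW v w \<and> deg_word w \<le> deg_word u}"
  have "wf ?W"
    by (intro wf_db_less_upto_aux wf_db_less_prime_upto assms)
  then obtain z where z: "z \<in> {w \<in> Q. deg_word w \<le> deg_word u}"
    and min: "\<And>y. (y, z) \<in> ?W \<Longrightarrow> y \<notin> {w \<in> Q. deg_word w \<le> deg_word u}"
    using \<open>u \<in> Q\<close> by (rule_tac wfE_min[of ?W u "{w \<in> Q. deg_word w \<le> deg_word u}"]) auto
  have "y \<notin> Q" if "db_less rX rW y z" for y
  proof -
    have "deg_word y \<le> deg_word z" using that by (auto simp: db_less_iff)
    then show ?thesis using min[of y] that z by auto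
  qed
  then show "\<exists>z\<in>Q. \<forall>y. (y, z) \<in> {(u, v). db_less rX rW u v} \<longrightarrow> y \<notin> Q"
    using z by blast
qed

text \<open>Words of equal degree and breadth are decided at their first differing primes, and two
  brackets with the same operator by their contents, which have smaller degree. Letters are
  comparable because both words use letters of \<open>X\<close> only.\<close>

lemma db_less_total:
  assumes "total_on X rX" "total rW"
    and "u \<in> bwords X" "v \<in> bwords X" "u \<noteq> v"
  shows "db_less rX rW u v \<or> db_less rX rW v u"
  using assms(3-)
proof (induction u arbitrary: v rule: measure_induct_rule[where f = deg_word])
  case (less u)
  show ?case
  proof (cases "deg_word u = deg_word v \<and> length u = length v")
    case False
    then show ?thesis by (auto simp: db_less_iff lenlex_conv)
  next
    case True
    with less.prems(3) obtain p a s b t where ab: "a \<noteq> b" and uv: "u = p @ [a] @ s" "v = p @ [b] @ t"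
      using same_length_different by blast
    have bw: "[a] \<in> bwords X" "[b] \<in> bwords X"
      using less.prems by (simp_all only: uv bwords_append)
    have "db_less_prime rX rW a b \<or> db_less_prime rX rW b a"
    proof (cases "deg_prime a = deg_prime b")
      case False
      then show ?thesis by (meson db_less_db_less_prime.prime_deg nat_neq_iff)
    next
      case deg: True
      show ?thesis
      proof (cases a; cases b)
        fix x y assume "a = Letter x" "b = Letter y"
        with ab bw assms(1) show ?thesis
          by (auto simp: total_on_def intro: db_less_db_less_prime.prime_letters)
      next
        fix x \<beta> w assume "a = Letter x" "b = Bracket \<beta> w"
        with deg show ?thesis using db_less_db_less_prime.prime_letter_bracket by metis
      next
        fix x \<beta> w assume "a = Bracket \<beta> w" "b = Letter x"
        with deg show ?thesis using db_less_db_less_prime.prime_letter_bracket by metis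
      next
        fix \<alpha> u' \<beta> v' assume eqs: "a = Bracket \<alpha> u'" "b = Bracket \<beta> v'"
        show ?thesis
        proof (cases "\<alpha> = \<beta>")
          case False
          with assms(2) have "(\<alpha>, \<beta>) \<in> rW - Id \<or> (\<beta>, \<alpha>) \<in> rW - Id"
            by (auto simp: total_on_def)
          with deg eqs show ?thesis using db_less_db_less_prime.prime_operators by metis
        next
          case True
          have "db_less rX rW u' v' \<or> db_less rX rW v' u'"
            using eqs True ab bw by (intro less.IH) (auto simp: uv)
          with deg eqs True show ?thesis using db_less_db_less_prime.prime_brackets by metis
        qed
      qed
    qed
    with True uv show ?thesis
      by (auto simp: db_less_iff lenlex_conv lex_appendI)
  qed
qed

text \<open>Outer factors add the same degree and breadth on both sides, and \<open>l\<close> merely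
  lengthens the common prefix before the first difference.\<close>

lemma db_less_context: "db_less rX rW u v \<Longrightarrow> db_less rX rW (l @ u @ r) (l @ v @ r)"
proof -
  assume "db_less rX rW u v"
  then consider "deg_word u < deg_word v"
    | "deg_word u = deg_word v" "length u < length v"
    | p a s b t where "deg_word u = deg_word v" "length u = length v"
        "u = p @ a # s" "v = p @ b # t" "db_less_prime rX rW a b"
    by (auto simp: db_less_iff lenlex_conv lex_conv)
  then show ?thesis
  proof cases
    case 3
    then show ?thesis
      by (intro db_less_db_less_prime.word_lex[where p = "l @ p" and a = a and s = "s @ r" and b = b and t = "t @ r"])
        auto
  qed (auto intro: db_less_db_less_prime.word_deg db_less_db_less_prime.word_breadth)
qed

lemma db_less_Bracket: "db_less rX rW u v \<Longrightarrow> db_less rX rW [Bracket \<omega> u] [Bracket \<omega> v]"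
proof -
  assume uv: "db_less rX rW u v"
  then have "deg_word u < deg_word v \<or> deg_word u = deg_word v" by (auto simp: db_less_iff)
  then show ?thesis
  proof
    assume "deg_word u = deg_word v"
    then show ?thesis
      by (intro db_less_db_less_prime.word_lex[where p = "[]" and s = "[]" and t = "[]",
        OF _ _ _ _ db_less_db_less_prime.prime_brackets[OF _ uv]]) auto
  qed (auto intro: db_less_db_less_prime.word_deg)
qed

lemma db_less_plug: "q \<in> star_words X \<Longrightarrow> db_less rX rW u v \<Longrightarrow> db_less rX rW (plug q u) (plug q v)"
proof (induction rule: star_words_induct)
  case (star l r)
  then show ?case by (simp add: db_less_context)
next
  case (Bracket l r \<omega> q)
  then show ?case
    using db_less_context[OF db_less_Bracket, of rX rW "plug q u" "plug q v" l \<omega> r] by simp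
qed

theorem monomial_order_db_order:
  assumes "well_order_on X rX" "well_order_on UNIV rW"
  shows "monomial_order X (db_order X rX rW)"
proof -
  let ?L = "{(u, v). db_less rX rW u v}"
  have rX: "wf (rX - Id)" "total_on X rX" and rW: "wf (rW - Id)" "total rW"
    using assms by (auto simp: well_order_on_def linear_order_on_def)
  have wf: "wf ?L" by (intro wf_db_less rX rW)
  have irr: "\<not> db_less rX rW u u" for u
    using wf_irrefl[OF wf, of u] by simp
  have asym: "\<not> db_less rX rW v u" if "db_less rX rW u v" for u v
    using wf_asym[OF wf, of u v] that by simp
  \<comment> \<open>Transitivity comes from totality instead of a case analysis: if u < v < w but
    not u < w, then w < u or u = w, and either gives a cycle in a well-founded relation.\<close>
  have cyc: False if "db_less rX rW u v" "db_less rX rW v w" "db_less rX rW w u" for u v w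
  proof -
    have "(u, v) \<in> ?L" "(v, w) \<in> ?L" "(w, u) \<in> ?L" using that by simp_all
    then have "(u, u) \<in> ?L\<^sup>+" by (rule trancl_into_trancl[OF trancl_into_trancl[OF r_into_trancl]])
    with wf show False by (meson wf_acyclic acyclic_def)
  qed
  have trans: "db_less rX rW u w"
    if "db_less rX rW u v" "db_less rX rW v w" "u \<in> bwords X" "v \<in> bwords X" "w \<in> bwords X" for u v w
    using db_less_total[OF rX(2) rW(2) that(3,5)] asym cyc that by blast
  have "well_order_on (bwords X) (db_order X rX rW)"
    unfolding well_order_on_def linear_order_on_def partial_order_on_def preorder_on_def
  proof (intro conjI)
    show "db_order X rX rW \<subseteq> bwords X \<times> bwords X" by (auto simp: db_order_def)
    show "refl_on (bwords X) (db_order X rX rW)" by (auto simp: db_order_def refl_on_def)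
    show "trans (db_order X rX rW)" unfolding db_order_def trans_def using trans by blast
    show "antisym (db_order X rX rW)" unfolding db_order_def antisym_def using asym by blast
    show "total_on (bwords X) (db_order X rX rW)"
      unfolding db_order_def total_on_def using db_less_total[OF rX(2) rW(2)] by blast
    show "wf (db_order X rX rW - Id)"
      by (rule wf_subset[OF wf]) (auto simp: db_order_def)
  qed
  moreover have "(plug q u, plug q v) \<in> db_order X rX rW - Id"
    if "u \<in> bwords X" "v \<in> bwords X" "q \<in> star_words X" "(u, v) \<in> db_order X rX rW - Id" for u v q
    using that db_less_plug[OF that(3), of rX rW u v] irr
    by (auto simp: db_order_def plug_in_bwords)
  ultimately show ?thesis unfolding monomial_order_def by blast
qed

section \<open>An explicit Rota-Baxter algebra\<close>

abbreviation brk :: "'w \<Rightarrow> (('x, 'w) bword \<Rightarrow>\<^sub>0 'k::comm_ring_1) \<Rightarrow> ('x, 'w) bword \<Rightarrow>\<^sub>0 'k" where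
  "brk \<omega> \<equiv> linear_ext (\<lambda>w. [Bracket \<omega> w])"

lemma monomial_Nil [simp]: "monomial [] = (1 :: 'a list \<Rightarrow>\<^sub>0 'k::comm_ring_1)"
  unfolding monomial_def zero_list_def[symmetric] by simp

lemma monomial_append: "monomial (u @ v) = (monomial u * monomial v :: 'a list \<Rightarrow>\<^sub>0 'k::comm_ring_1)"
  by (simp add: monomial_mult plus_list_def)

text \<open>The outer parts \<open>butlast u\<close> and \<open>tl v\<close> are attached by plain
  concatenation: in a reduced word the neighbour of a bracket is a letter, so attaching them creates
  no adjacent brackets. Inside the new brackets such pairs can arise, hence the recursive products
  there.\<close>

function dia :: "'w four_ops \<Rightarrow> ('x, 'w) bword \<Rightarrow> ('x, 'w) bword \<Rightarrow> ('x, 'w) bword \<Rightarrow>\<^sub>0 'k::comm_ring_1" where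
  "dia Om u v =
     (if u = [] \<or> v = [] then monomial (u @ v)
      else case (last u, hd v) of
        (Bracket \<alpha> a, Bracket \<beta> b) \<Rightarrow>
          monomial (butlast u) *
          (brk (\<alpha> \<^bold>\<rightarrow>\<^bsub>Om\<^esub> \<beta>) (dia Om [Bracket (\<alpha> \<^bold>\<rhd>\<^bsub>Om\<^esub> \<beta>) a] b) +
           brk (\<alpha> \<^bold>\<leftarrow>\<^bsub>Om\<^esub> \<beta>) (dia Om a [Bracket (\<alpha> \<^bold>\<lhd>\<^bsub>Om\<^esub> \<beta>) b])) *
          monomial (tl v)
      | _ \<Rightarrow> monomial (u @ v))"
  by auto

termination
proof (relation "measure (\<lambda>(Om, u, v). deg_word u + deg_word v)")
  fix Om :: "'w four_ops" and u v :: "('x, 'w) bword" and p q \<alpha> a \<beta> b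
  assume uv: "\<not> (u = [] \<or> v = [])" "(p, q) = (last u, hd v)" "p = Bracket \<alpha> a" "q = Bracket \<beta> b"
  then have "u = butlast u @ [Bracket \<alpha> a]" "v = Bracket \<beta> b # tl v"
    by (metis append_butlast_last_id Pair_inject, metis list.collapse Pair_inject)
  then have "deg_word u = deg_word (butlast u) + Suc (deg_word a)" "deg_word v = Suc (deg_word b) + deg_word (tl v)"
    by (metis deg_word_simps deg_prime_Bracket add_0_right)+
  \<comment> \<open>Each call opens one of the two brackets and keeps the other, up to its label, so
    the total degree drops by at least one.\<close>
  then show "((Om, [Bracket (\<alpha> \<^bold>\<rhd>\<^bsub>Om\<^esub> \<beta>) a], b), (Om, u, v)) \<in> measure (\<lambda>(Om, u, v). deg_word u + deg_word v)"
    and "((Om, a, [Bracket (\<alpha> \<^bold>\<lhd>\<^bsub>Om\<^esub> \<beta>) b]), (Om, u, v)) \<in> measure (\<lambda>(Om, u, v). deg_word u + deg_word v)"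
    by simp_all
qed simp

declare dia.simps [simp del]

lemma dia_Nil [simp]: "dia Om [] v = monomial v" "dia Om u [] = monomial u"
  by (simp_all add: dia.simps)

lemma dia_Letter_left: "dia Om (u @ [Letter x]) v = monomial (u @ [Letter x] @ v)"
  by (simp add: dia.simps)

lemma dia_Letter_right: "dia Om u (Letter x # v) = monomial (u @ Letter x # v)"
  by (simp add: dia.simps[of Om u] split: bprime.split)

lemma dia_Bracket:
  "dia Om [Bracket \<alpha> a] [Bracket \<beta> b] =
     brk (\<alpha> \<^bold>\<rightarrow>\<^bsub>Om\<^esub> \<beta>) (dia Om [Bracket (\<alpha> \<^bold>\<rhd>\<^bsub>Om\<^esub> \<beta>) a] b) +
     brk (\<alpha> \<^bold>\<leftarrow>\<^bsub>Om\<^esub> \<beta>) (dia Om a [Bracket (\<alpha> \<^bold>\<lhd>\<^bsub>Om\<^esub> \<beta>) b])"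
  by (simp add: dia.simps[of Om "[_]" "[_]"])

text \<open>Only the last prime of the left factor meets \<open>v\<close>, and for nonempty
  \<open>a\<close> that prime belongs to \<open>a\<close>.\<close>

lemma dia_append_left: "a \<noteq> [] \<Longrightarrow> dia Om (u @ a) v = monomial u * dia Om a v"
  by (subst (1 2) dia.simps) (auto simp: monomial_append butlast_append mult.assoc split: bprime.split)

lemma dia_append_right: "b \<noteq> [] \<Longrightarrow> dia Om u (b @ v) = dia Om u b * monomial v"
  by (subst (1 2) dia.simps) (auto simp: monomial_append mult.assoc split: bprime.split)

lemma Nil_notin_keys_brk: "[] \<notin> keys (brk \<omega> f)"
  using keys_linear_ext[of "\<lambda>w. [Bracket \<omega> w]" f] by auto

text \<open>Supplies the support condition of \<open>dprod_mult_left\<close> and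
  \<open>dprod_mult_right\<close> for products of two primes, so that outer factors can be moved out
  of a double product.\<close>

lemma Nil_notin_keys_dia: "keys (dia Om [a] [b] :: ('x, 'w) bword \<Rightarrow>\<^sub>0 'k::comm_ring_1) \<subseteq> - {[]}"
proof (cases "\<exists>\<alpha> u \<beta> v. a = Bracket \<alpha> u \<and> b = Bracket \<beta> v")
  case True
  then obtain \<alpha> u \<beta> v where ab: "a = Bracket \<alpha> u" "b = Bracket \<beta> v" by blast
  have "keys (brk \<xi> f + brk \<eta> g) \<subseteq> - {[]}" for \<xi> \<eta> and f g :: "('x, 'w) bword \<Rightarrow>\<^sub>0 'k"
  proof -
    have "[] \<notin> keys (brk \<xi> f) \<union> keys (brk \<eta> g)" by (simp add: Nil_notin_keys_brk)
    then have "[] \<notin> keys (brk \<xi> f + brk \<eta> g)" by (rule contra_subsetD[OF keys_add])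
    then show ?thesis by simp
  qed
  then show ?thesis unfolding ab dia_Bracket .
next
  case False
  then have "dia Om [a] [b] = (monomial [a, b] :: _ \<Rightarrow>\<^sub>0 'k)"
    by (auto simp: dia.simps[of Om "[a]" "[b]"] split: bprime.split)
  then show ?thesis by simp
qed

section \<open>The bilinear product and its compatibility with concatenation\<close>

definition dprod :: "'w four_ops \<Rightarrow> (('x, 'w) bword \<Rightarrow>\<^sub>0 'k::comm_ring_1) \<Rightarrow> (('x, 'w) bword \<Rightarrow>\<^sub>0 'k) \<Rightarrow> ('x, 'w) bword \<Rightarrow>\<^sub>0 'k" where
  "dprod Om f g = lin (\<lambda>u. lin (dia Om u) g) f"

lemma dprod_simps [simp]:
  "dprod Om 0 g = 0" "dprod Om f 0 = 0" "dprod Om (monomial u) (monomial v) = dia Om u v"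
  by (simp_all add: dprod_def)

lemma dprod_add_left: "dprod Om (f + f') g = dprod Om f g + dprod Om f' g"
  by (simp add: dprod_def lin_add)

lemma dprod_add_right: "dprod Om f (g + g') = dprod Om f g + dprod Om f g'"
  by (simp add: dprod_def lin_add lin_add_fun)

lemma dprod_scale_left: "dprod Om (scale c f) g = scale c (dprod Om f g)"
  by (simp add: dprod_def lin_scale)

lemma dprod_scale_right: "dprod Om f (scale c g) = scale c (dprod Om f g)"
  by (simp add: dprod_def lin_scale lin_scale_fun)

lemmas dprod_linear = dprod_add_left dprod_add_right dprod_scale_left dprod_scale_right
  scale_add distrib_left distrib_right scale_mult_left scale_mult_right linear_ext_add linear_ext_scale

lemma dprod_one_left [simp]: "dprod Om 1 g = g"
proof (induction g rule: linear_induct[OF subset_UNIV])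
  case (3 c w)
  then show ?case by (simp add: dprod_linear flip: monomial_Nil)
qed (simp_all add: dprod_linear)

lemma dprod_one_right [simp]: "dprod Om f 1 = f"
proof (induction f rule: linear_induct[OF subset_UNIV])
  case (3 c w)
  then show ?case by (simp add: dprod_linear flip: monomial_Nil)
qed (simp_all add: dprod_linear)

text \<open>
  The empty word is excluded: multiplying it by \<open>h\<close> would let \<open>h\<close> interact with \<open>g\<close>.
\<close>

lemma dprod_mult_left:
  assumes "keys f \<subseteq> - {[]}"
  shows "dprod Om (h * f) g = h * dprod Om f g"
  using assms
proof (induction f rule: linear_induct)
  case (monomial c u)
  show ?case
  proof (induction g rule: linear_induct[OF subset_UNIV])
    case (3 d w)
    show ?case
    proof (induction h rule: linear_induct[OF subset_UNIV])
      case (3 e v)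
      show ?case
        using monomial by (simp add: dprod_linear dia_append_left flip: monomial_append)
    qed (simp_all add: dprod_linear)
  qed (simp_all add: dprod_linear)
qed (simp_all add: dprod_linear)

lemma dprod_mult_right:
  assumes "keys g \<subseteq> - {[]}"
  shows "dprod Om f (g * h) = dprod Om f g * h"
  using assms
proof (induction g rule: linear_induct)
  case (monomial c u)
  show ?case
  proof (induction f rule: linear_induct[OF subset_UNIV])
    case (3 d w)
    show ?case
    proof (induction h rule: linear_induct[OF subset_UNIV])
      case (3 e v)
      show ?case
        using monomial by (simp add: dprod_linear dia_append_right flip: monomial_append)
    qed (simp_all add: dprod_linear)
  qed (simp_all add: dprod_linear)
qed (simp_all add: dprod_linear)

lemma dprod_Letter_left: "dprod Om (monomial [Letter x]) g = monomial [Letter x] * g"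
proof (induction g rule: linear_induct[OF subset_UNIV])
  case (3 d w)
  show ?case
    by (simp add: dprod_linear dia_Letter_left[of Om "[]", simplified] flip: monomial_append)
qed (simp_all add: dprod_linear)

lemma dprod_Letter_right: "dprod Om f (monomial [Letter x]) = f * monomial [Letter x]"
proof (induction f rule: linear_induct[OF subset_UNIV])
  case (3 d w)
  show ?case
    by (simp add: dprod_linear dia_Letter_right flip: monomial_append)
qed (simp_all add: dprod_linear)

text \<open>Both sides are bilinear in \<open>f\<close> and \<open>g\<close>, and on words this is
  the defining recursion \<open>dia_Bracket\<close>.\<close>

lemma dprod_rota_baxter:
  "dprod Om (brk \<alpha> f) (brk \<beta> g) =
     brk (\<alpha> \<^bold>\<rightarrow>\<^bsub>Om\<^esub> \<beta>) (dprod Om (brk (\<alpha> \<^bold>\<rhd>\<^bsub>Om\<^esub> \<beta>) f) g) +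
     brk (\<alpha> \<^bold>\<leftarrow>\<^bsub>Om\<^esub> \<beta>) (dprod Om f (brk (\<alpha> \<^bold>\<lhd>\<^bsub>Om\<^esub> \<beta>) g))"
proof (induction f rule: linear_induct[OF subset_UNIV])
  case (3 c u)
  show ?case
  proof (induction g rule: linear_induct[OF subset_UNIV])
    case (3 d v)
    show ?case by (simp add: dprod_linear dia_Bracket)
  qed (simp_all add: dprod_linear algebra_simps)
qed (simp_all add: dprod_linear algebra_simps)

section \<open>Associativity from the fifteen axioms\<close>

context ext_diassociative_semigroup
begin

text \<open>Applying the Rota-Baxter identity twice gives four brackets on each side. Sort them by
  which of \<open>f\<close>, \<open>g\<close>, \<open>h\<close> is left without a bracket of its own
  when the contents are regrouped as triple products. For \<open>h\<close> there are two terms on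
  the left against one on the right, for \<open>f\<close> one against two, for \<open>g\<close> one
  against one. Each induction hypothesis regroups one class; it is quantified over the labels
  because these change on the way.\<close>

lemma dprod_assoc_brk:
  assumes IH1: "\<And>\<xi> \<eta>. dprod Om (dprod Om (brk \<xi> f) (brk \<eta> g)) h = dprod Om (brk \<xi> f) (dprod Om (brk \<eta> g) h)"
    and IH2: "\<And>\<xi> \<eta>. dprod Om (dprod Om (brk \<xi> f) g) (brk \<eta> h) = dprod Om (brk \<xi> f) (dprod Om g (brk \<eta> h))"
    and IH3: "\<And>\<xi> \<eta>. dprod Om (dprod Om f (brk \<xi> g)) (brk \<eta> h) = dprod Om f (dprod Om (brk \<xi> g) (brk \<eta> h))"
  shows "dprod Om (dprod Om (brk \<alpha> f) (brk \<beta> g)) (brk \<gamma> h) = dprod Om (brk \<alpha> f) (dprod Om (brk \<beta> g) (brk \<gamma> h))"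
proof -
  let ?p = "dprod Om"
  \<comment> \<open>The class of \<open>h\<close>: reassociating the single content on the right and
    applying the Rota-Baxter identity once more produces the two contents on the left.\<close>
  have T1: "?p (brk (\<alpha> \<^bold>\<rhd> (\<beta> \<^bold>\<rightarrow> \<gamma>)) f) (?p (brk (\<beta> \<^bold>\<rhd> \<gamma>) g) h) =
      ?p (brk ((\<alpha> \<^bold>\<rightarrow> \<beta>) \<^bold>\<rhd> \<gamma>) (?p (brk (\<alpha> \<^bold>\<rhd> \<beta>) f) g)) h +
      ?p (brk ((\<alpha> \<^bold>\<leftarrow> \<beta>) \<^bold>\<rhd> \<gamma>) (?p f (brk (\<alpha> \<^bold>\<lhd> \<beta>) g))) h"
    unfolding IH1[symmetric] dprod_rota_baxter dprod_add_left eds8 eds9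
    unfolding eds2[symmetric] eds3[symmetric] ..
  \<comment> \<open>The class of \<open>f\<close>, the mirror image: here the single content is on
    the left.\<close>
  have T4: "?p (?p f (brk (\<alpha> \<^bold>\<lhd> \<beta>) g)) (brk ((\<alpha> \<^bold>\<leftarrow> \<beta>) \<^bold>\<lhd> \<gamma>) h) =
      ?p f (brk (\<alpha> \<^bold>\<lhd> (\<beta> \<^bold>\<rightarrow> \<gamma>)) (?p (brk (\<beta> \<^bold>\<rhd> \<gamma>) g) h)) +
      ?p f (brk (\<alpha> \<^bold>\<lhd> (\<beta> \<^bold>\<leftarrow> \<gamma>)) (?p g (brk (\<beta> \<^bold>\<lhd> \<gamma>) h)))"
    unfolding IH3 dprod_rota_baxter dprod_add_right eds11 eds12 eds14 eds15 ..
  \<comment> \<open>By \<open>eds1\<close> and \<open>eds7\<close> the two brackets of the class of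
    \<open>h\<close> carry the same outer label, so they merge through \<open>T1\<close>;
    \<open>eds4\<close>, \<open>eds6\<close> and \<open>IH2\<close> settle the class of
    \<open>g\<close>.\<close>
  have "?p (?p (brk \<alpha> f) (brk \<beta> g)) (brk \<gamma> h) =
      brk (\<alpha> \<^bold>\<rightarrow> (\<beta> \<^bold>\<rightarrow> \<gamma>)) (?p (brk (\<alpha> \<^bold>\<rhd> (\<beta> \<^bold>\<rightarrow> \<gamma>)) f) (?p (brk (\<beta> \<^bold>\<rhd> \<gamma>) g) h)) +
      brk (\<alpha> \<^bold>\<rightarrow> (\<beta> \<^bold>\<leftarrow> \<gamma>)) (?p (brk (\<alpha> \<^bold>\<rhd> \<beta>) f) (?p g (brk (\<beta> \<^bold>\<lhd> \<gamma>) h))) +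
      brk ((\<alpha> \<^bold>\<leftarrow> \<beta>) \<^bold>\<leftarrow> \<gamma>) (?p (?p f (brk (\<alpha> \<^bold>\<lhd> \<beta>) g)) (brk ((\<alpha> \<^bold>\<leftarrow> \<beta>) \<^bold>\<lhd> \<gamma>) h))"
    unfolding T1 dprod_rota_baxter dprod_add_left linear_ext_add eds1 eds4 eds6 eds7 IH2
    by (simp only: ac_simps)
  \<comment> \<open>The outer label equals both \<alpha> \<leftarrow> (\<beta> \<rightarrow>
    \<gamma>) and \<alpha> \<leftarrow> (\<beta> \<leftarrow> \<gamma>), by \<open>eds10\<close> and
    \<open>eds13\<close>; each summand of \<open>T4\<close> uses one of these forms.\<close>
  also have "brk ((\<alpha> \<^bold>\<leftarrow> \<beta>) \<^bold>\<leftarrow> \<gamma>) (?p (?p f (brk (\<alpha> \<^bold>\<lhd> \<beta>) g)) (brk ((\<alpha> \<^bold>\<leftarrow> \<beta>) \<^bold>\<lhd> \<gamma>) h)) =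
      brk (\<alpha> \<^bold>\<leftarrow> (\<beta> \<^bold>\<rightarrow> \<gamma>)) (?p f (brk (\<alpha> \<^bold>\<lhd> (\<beta> \<^bold>\<rightarrow> \<gamma>)) (?p (brk (\<beta> \<^bold>\<rhd> \<gamma>) g) h))) +
      brk (\<alpha> \<^bold>\<leftarrow> (\<beta> \<^bold>\<leftarrow> \<gamma>)) (?p f (brk (\<alpha> \<^bold>\<lhd> (\<beta> \<^bold>\<leftarrow> \<gamma>)) (?p g (brk (\<beta> \<^bold>\<lhd> \<gamma>) h))))"
    unfolding T4 linear_ext_add using eds10 eds13 by metis
  also have "brk (\<alpha> \<^bold>\<rightarrow> (\<beta> \<^bold>\<rightarrow> \<gamma>)) (?p (brk (\<alpha> \<^bold>\<rhd> (\<beta> \<^bold>\<rightarrow> \<gamma>)) f) (?p (brk (\<beta> \<^bold>\<rhd> \<gamma>) g) h)) +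
      brk (\<alpha> \<^bold>\<rightarrow> (\<beta> \<^bold>\<leftarrow> \<gamma>)) (?p (brk (\<alpha> \<^bold>\<rhd> \<beta>) f) (?p g (brk (\<beta> \<^bold>\<lhd> \<gamma>) h))) + \<dots> =
      ?p (brk \<alpha> f) (?p (brk \<beta> g) (brk \<gamma> h))"
    unfolding dprod_rota_baxter dprod_add_right linear_ext_add eds5
    by (simp only: ac_simps)
  finally show ?thesis .
qed

text \<open>If \<open>v\<close> has at least two primes, the two products act on different ends of
  it and commute. If \<open>v\<close> is a single prime, everything beyond the adjacent primes of
  \<open>u\<close> and \<open>w\<close> factors out and three primes remain. A letter among these
  leaves at most one meeting pair of brackets; three brackets are the case of
  \<open>dprod_assoc_brk\<close>.\<close>

lemma dia_assoc:
  fixes u v w :: "('x, 'w) bword"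
  shows "dprod Om (dia Om u v) (monomial w) = (dprod Om (monomial u) (dia Om v w) :: _ \<Rightarrow>\<^sub>0 'k::comm_ring_1)"
proof (induction "deg_word u + deg_word v + deg_word w" arbitrary: u v w rule: less_induct)
  case less
  consider "u = [] \<or> v = [] \<or> w = []"
    | b v' where "v = [b] @ v'" "v' \<noteq> []"
    | u' a b c w' where "u = u' @ [a]" "v = [b]" "w = [c] @ w'"
    by (metis append_Cons append_Nil neq_Nil_conv rev_exhaust)
  then show ?case
  proof cases
    case 1
    then show ?thesis by auto
  next
    case 2
    have "dprod Om (dia Om u v) (monomial w) = (dia Om u [b] * dia Om v' w :: _ \<Rightarrow>\<^sub>0 'k)"
      unfolding 2(1) by (subst dia_append_right) (use 2(2) in \<open>simp_all add: dprod_mult_left\<close>)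
    moreover have "dprod Om (monomial u) (dia Om v w) = (dia Om u [b] * dia Om v' w :: _ \<Rightarrow>\<^sub>0 'k)"
      unfolding 2(1) by (subst dia_append_left) (use 2(2) in \<open>simp_all add: dprod_mult_right\<close>)
    ultimately show ?thesis by simp
  next
    case 3
    have single: "dprod Om (dia Om [a] [b]) (monomial [c]) = (dprod Om (monomial [a]) (dia Om [b] [c]) :: _ \<Rightarrow>\<^sub>0 'k)"
    proof (cases a; cases b; cases c)
      fix \<alpha> f \<beta> g \<gamma> h
      assume abc: "a = Bracket \<alpha> f" "b = Bracket \<beta> g" "c = Bracket \<gamma> h"
      have IH: "dprod Om (dia Om x y) (monomial z) = (dprod Om (monomial x) (dia Om y z) :: _ \<Rightarrow>\<^sub>0 'k)"
        if "deg_word x + deg_word y + deg_word z < deg_word u + deg_word v + deg_word w" for x y z :: "('x, 'w) bword"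
        using less that by blast
      have "dprod Om (dprod Om (brk \<alpha> (monomial f)) (brk \<beta> (monomial g))) (brk \<gamma> (monomial h)) =
          (dprod Om (brk \<alpha> (monomial f)) (dprod Om (brk \<beta> (monomial g)) (brk \<gamma> (monomial h))) :: _ \<Rightarrow>\<^sub>0 'k)"
        \<comment> \<open>In every hypothesis one of the three brackets is opened, so the total
          degree is smaller.\<close>
        by (rule dprod_assoc_brk) (simp_all add: IH abc 3)
      then show ?thesis by (simp add: abc)
    qed (auto simp: dprod_Letter_left dprod_Letter_right dia_Letter_right dia_Letter_left[of _ "[]", simplified]
        dia_append_left[of "[_]" _ "[_]", simplified] dia_append_right[of "[_]" _ _ "[_]", simplified]
        simp flip: monomial_append)
    have "dprod Om (dia Om u v) (monomial w) =
        (monomial u' * dprod Om (dia Om [a] [b]) (monomial [c]) * monomial w' :: _ \<Rightarrow>\<^sub>0 'k)"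
      unfolding 3 monomial_append dia_append_left[OF not_Cons_self2]
      by (simp add: dprod_mult_left dprod_mult_right
          dprod_mult_left[OF Nil_notin_keys_dia] dprod_mult_right[OF Nil_notin_keys_dia] mult.assoc)
    also have "\<dots> = dprod Om (monomial u) (dia Om v w)"
      unfolding 3 single monomial_append dia_append_right[OF not_Cons_self2]
      by (simp add: dprod_mult_left dprod_mult_right
          dprod_mult_left[OF Nil_notin_keys_dia] dprod_mult_right[OF Nil_notin_keys_dia] mult.assoc)
    finally show ?thesis .
  qed
qed

theorem dprod_assoc: "dprod Om (dprod Om f g) h = dprod Om f (dprod Om g h)"
proof (induction f rule: linear_induct[OF subset_UNIV])
  case (3 c u)
  show ?case
  proof (induction g rule: linear_induct[OF subset_UNIV])
    case (3 d v)
    show ?case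
    proof (induction h rule: linear_induct[OF subset_UNIV])
      case (3 e w)
      show ?case by (simp add: dprod_linear dia_assoc)
    qed (simp_all add: dprod_linear)
  qed (simp_all add: dprod_linear)
qed (simp_all add: dprod_linear)

end

section \<open>Operated algebras\<close>

lemma ring_of_type_algebra_simps [simp]:
  "carrier ring_of_type_algebra = UNIV"
  "monoid.mult ring_of_type_algebra = (*)"
  "one ring_of_type_algebra = 1"
  "ring.zero ring_of_type_algebra = 0"
  "add ring_of_type_algebra = (+)"
  by (simp_all add: ring_of_type_algebra_def)

text \<open>A flat list of elementwise laws, in a form that simplification can check; the algebra of
  words, images under homomorphisms and the \<diamondop>-algebra are all verified through
  it.\<close>

lemma operated_algebraI:
  fixes A :: "('k::comm_ring_1, 'a, 'w) operated_algebra" (structure)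
  assumes add: "\<And>x y. x \<in> carrier A \<Longrightarrow> y \<in> carrier A \<Longrightarrow> x \<oplus> y \<in> carrier A"
      "\<And>x y z. x \<in> carrier A \<Longrightarrow> y \<in> carrier A \<Longrightarrow> z \<in> carrier A \<Longrightarrow> (x \<oplus> y) \<oplus> z = x \<oplus> (y \<oplus> z)"
      "\<And>x y. x \<in> carrier A \<Longrightarrow> y \<in> carrier A \<Longrightarrow> x \<oplus> y = y \<oplus> x"
    and zero: "\<zero> \<in> carrier A" "\<And>x. x \<in> carrier A \<Longrightarrow> \<zero> \<oplus> x = x"
    and neg: "\<And>x. x \<in> carrier A \<Longrightarrow> \<exists>y\<in>carrier A. y \<oplus> x = \<zero>"
    and mult: "\<And>x y. x \<in> carrier A \<Longrightarrow> y \<in> carrier A \<Longrightarrow> x \<otimes> y \<in> carrier A"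
      "\<And>x y z. x \<in> carrier A \<Longrightarrow> y \<in> carrier A \<Longrightarrow> z \<in> carrier A \<Longrightarrow> (x \<otimes> y) \<otimes> z = x \<otimes> (y \<otimes> z)"
    and one: "\<one> \<in> carrier A" "\<And>x. x \<in> carrier A \<Longrightarrow> \<one> \<otimes> x = x" "\<And>x. x \<in> carrier A \<Longrightarrow> x \<otimes> \<one> = x"
    and distr: "\<And>x y z. x \<in> carrier A \<Longrightarrow> y \<in> carrier A \<Longrightarrow> z \<in> carrier A \<Longrightarrow> (x \<oplus> y) \<otimes> z = x \<otimes> z \<oplus> y \<otimes> z"
      "\<And>x y z. x \<in> carrier A \<Longrightarrow> y \<in> carrier A \<Longrightarrow> z \<in> carrier A \<Longrightarrow> z \<otimes> (x \<oplus> y) = z \<otimes> x \<oplus> z \<otimes> y"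
    and smult: "\<And>c x. x \<in> carrier A \<Longrightarrow> c \<odot> x \<in> carrier A"
      "\<And>c d x. x \<in> carrier A \<Longrightarrow> (c + d) \<odot> x = c \<odot> x \<oplus> d \<odot> x"
      "\<And>c x y. x \<in> carrier A \<Longrightarrow> y \<in> carrier A \<Longrightarrow> c \<odot> (x \<oplus> y) = c \<odot> x \<oplus> c \<odot> y"
      "\<And>c d x. x \<in> carrier A \<Longrightarrow> (c * d) \<odot> x = c \<odot> (d \<odot> x)"
      "\<And>x. x \<in> carrier A \<Longrightarrow> 1 \<odot> x = x"
      "\<And>c x y. x \<in> carrier A \<Longrightarrow> y \<in> carrier A \<Longrightarrow> (c \<odot> x) \<otimes> y = c \<odot> (x \<otimes> y)"
      "\<And>c x y. x \<in> carrier A \<Longrightarrow> y \<in> carrier A \<Longrightarrow> x \<otimes> (c \<odot> y) = c \<odot> (x \<otimes> y)"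
    and oper: "\<And>\<omega> x. x \<in> carrier A \<Longrightarrow> oper A \<omega> x \<in> carrier A"
      "\<And>\<omega> x y. x \<in> carrier A \<Longrightarrow> y \<in> carrier A \<Longrightarrow> oper A \<omega> (x \<oplus> y) = oper A \<omega> x \<oplus> oper A \<omega> y"
      "\<And>\<omega> c x. x \<in> carrier A \<Longrightarrow> oper A \<omega> (c \<odot> x) = c \<odot> oper A \<omega> x"
  shows "operated_algebra A"
proof -
  have ab: "abelian_group A"
    by (rule abelian_groupI; fact add zero neg)
  have "ring A"
    by (rule ringI, fact ab, rule monoidI; fact mult one distr)
  moreover have "module (ring_of_type_algebra :: 'k ring) A"
    by (rule moduleI, rule cring_from_type_algebra, fact ab; simp; fact smult)
  ultimately show ?thesis
    by (rule operated_algebra.intro) (fact smult oper)+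
qed

lemma operated_homD:
  assumes "\<phi> \<in> operated_hom A B" "x \<in> carrier A"
  shows "\<phi> x \<in> carrier B"
    "y \<in> carrier A \<Longrightarrow> \<phi> (x \<otimes>\<^bsub>A\<^esub> y) = \<phi> x \<otimes>\<^bsub>B\<^esub> \<phi> y"
    "y \<in> carrier A \<Longrightarrow> \<phi> (x \<oplus>\<^bsub>A\<^esub> y) = \<phi> x \<oplus>\<^bsub>B\<^esub> \<phi> y"
    "\<phi> (c \<odot>\<^bsub>A\<^esub> x) = c \<odot>\<^bsub>B\<^esub> \<phi> x"
    "\<phi> (oper A \<omega> x) = oper B \<omega> (\<phi> x)"
  using assms by (auto simp: operated_hom_def ring_hom_def)

lemma operated_hom_one: "\<phi> \<in> operated_hom A B \<Longrightarrow> \<phi> \<one>\<^bsub>A\<^esub> = \<one>\<^bsub>B\<^esub>"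
  by (auto simp: operated_hom_def ring_hom_def)

lemma operated_homI:
  assumes "\<And>x. x \<in> carrier A \<Longrightarrow> \<phi> x \<in> carrier B"
    and "\<And>x y. x \<in> carrier A \<Longrightarrow> y \<in> carrier A \<Longrightarrow> \<phi> (x \<otimes>\<^bsub>A\<^esub> y) = \<phi> x \<otimes>\<^bsub>B\<^esub> \<phi> y"
    and "\<And>x y. x \<in> carrier A \<Longrightarrow> y \<in> carrier A \<Longrightarrow> \<phi> (x \<oplus>\<^bsub>A\<^esub> y) = \<phi> x \<oplus>\<^bsub>B\<^esub> \<phi> y"
    and "\<phi> \<one>\<^bsub>A\<^esub> = \<one>\<^bsub>B\<^esub>"
    and "\<And>c x. x \<in> carrier A \<Longrightarrow> \<phi> (c \<odot>\<^bsub>A\<^esub> x) = c \<odot>\<^bsub>B\<^esub> \<phi> x"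
    and "\<And>\<omega> x. x \<in> carrier A \<Longrightarrow> \<phi> (oper A \<omega> x) = oper B \<omega> (\<phi> x)"
  shows "\<phi> \<in> operated_hom A B"
  using assms by (auto simp: operated_hom_def intro: ring_hom_memI)

context operated_algebra
begin

interpretation ring A by (rule is_ring)
interpretation M: module "ring_of_type_algebra :: 'k ring" A by (rule is_module)

text \<open>Identities pass along a surjection that preserves the operations, and the image of a
  negative is a negative. Membership in \<open>operated_hom\<close> does not presuppose that
  \<open>B\<close> is an algebra and does not mention zero, so preservation of zero is a separate
  assumption.\<close>

lemma operated_algebra_image:
  fixes B :: "('k, 'b, 'w) operated_algebra"
  assumes onto: "carrier B = \<phi> ` carrier A" and hom: "\<phi> \<in> operated_hom A B" and zero: "\<phi> \<zero> = \<zero>\<^bsub>B\<^esub>"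
  shows "operated_algebra B"
proof -
  note h = operated_homD(2-)[OF hom, symmetric] operated_hom_one[OF hom, symmetric] zero[symmetric]
  note d = M.smult_l_distr M.smult_r_distr M.smult_assoc1 M.smult_one
  have neg: "\<exists>b\<in>carrier A. \<phi> (b \<oplus> a) = \<phi> \<zero>" if "a \<in> carrier A" for a
    using that by (intro bexI[of _ "\<ominus> a"]) (simp_all add: l_neg)
  show ?thesis
    by (rule operated_algebraI; (unfold onto)?; (elim imageE)?; hypsubst?)
      (simp_all add: h neg m_assoc a_assoc l_distr r_distr smult_mult_left smult_mult_right
        oper_closed oper_add oper_smult,
        simp_all only: d[unfolded ring_of_type_algebra_simps] UNIV_I a_comm)
qed

lemma oper_zero: "oper A \<omega> \<zero> = \<zero>"
  using oper_smult[of \<zero> \<omega> 0] M.smult_l_null by (simp add: oper_closed)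

text \<open>Ideals are closed under multiplication by ring elements, and a scalar c acts as
  multiplication by c times the unit.\<close>

lemma operated_ideal_smult:
  assumes "operated_ideal I A" "x \<in> I"
  shows "c \<odot> x \<in> I"
proof -
  interpret ideal I A using assms by (simp add: operated_ideal_def)
  have "c \<odot> x = (c \<odot> \<one>) \<otimes> x"
    using assms(2) by (simp add: smult_mult_left)
  also have "\<dots> \<in> I"
    using assms(2) M.smult_closed[of c \<one>] by (intro I_l_closed) auto
  finally show ?thesis .
qed

lemma gen_operated_ideal:
  assumes "S \<subseteq> carrier A"
  shows "operated_ideal (gen_operated_ideal A S) A" "S \<subseteq> gen_operated_ideal A S"
proof -
  have "operated_ideal (carrier A) A"
    by (simp add: operated_ideal_def oneideal oper_closed)
  then have "{I. operated_ideal I A \<and> S \<subseteq> I} \<noteq> {}" using assms by blast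
  then have "ideal (gen_operated_ideal A S) A"
    unfolding gen_operated_ideal_def by (intro i_Intersect) (auto simp: operated_ideal_def)
  then show "operated_ideal (gen_operated_ideal A S) A"
    by (auto simp: operated_ideal_def gen_operated_ideal_def)
qed (auto simp: gen_operated_ideal_def)

lemma operated_ideal_kernel:
  assumes "operated_algebra B" "\<phi> \<in> operated_hom A B"
  shows "operated_ideal {x \<in> carrier A. \<phi> x = \<zero>\<^bsub>B\<^esub>} A"
proof -
  interpret B: operated_algebra B by fact
  interpret ring_hom_ring A B \<phi>
    using assms(2) by (intro ring_hom_ringI2 is_ring B.is_ring) (simp add: operated_hom_def)
  have "a_kernel A B \<phi> = {x \<in> carrier A. \<phi> x = \<zero>\<^bsub>B\<^esub>}" by (rule a_kernel_def')
  then have "ideal {x \<in> carrier A. \<phi> x = \<zero>\<^bsub>B\<^esub>} A"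
    using kernel_is_ideal by simp
  moreover have "\<phi> (oper A \<omega> x) = \<zero>\<^bsub>B\<^esub>" if "x \<in> carrier A" "\<phi> x = \<zero>\<^bsub>B\<^esub>" for \<omega> x
    unfolding operated_homD(5)[OF assms(2) that(1)] that(2) by (rule B.oper_zero)
  ultimately show ?thesis
    unfolding operated_ideal_def using oper_closed by blast
qed

lemma gen_operated_ideal_subset_kernel:
  assumes "operated_algebra B" "\<phi> \<in> operated_hom A B" "S \<subseteq> carrier A" "\<And>s. s \<in> S \<Longrightarrow> \<phi> s = \<zero>\<^bsub>B\<^esub>"
    and "x \<in> gen_operated_ideal A S"
  shows "\<phi> x = \<zero>\<^bsub>B\<^esub>"
proof -
  have "gen_operated_ideal A S \<subseteq> {x \<in> carrier A. \<phi> x = \<zero>\<^bsub>B\<^esub>}"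
    unfolding gen_operated_ideal_def using operated_ideal_kernel[OF assms(1,2)] assms(3,4) by blast
  with assms(5) show ?thesis by blast
qed

lemma quotient_algebra_simps:
  assumes "operated_ideal I A"
  shows "carrier (quotient_algebra A I) = (+>) I ` carrier A"
    and "\<zero>\<^bsub>quotient_algebra A I\<^esub> = I +> \<zero>"
    and "\<lbrakk>x \<in> carrier A; y \<in> carrier A\<rbrakk> \<Longrightarrow> I +> x = I +> y \<longleftrightarrow> x \<ominus> y \<in> I"
    and "(+>) I \<in> operated_hom A (quotient_algebra A I)"
    and "operated_algebra (quotient_algebra A I)"
proof -
  interpret ideal I A using assms by (simp add: operated_ideal_def)
  show carrier: "carrier (quotient_algebra A I) = (+>) I ` carrier A"
    by (auto simp: quotient_algebra_def FactRing_simps)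
  show zero: "\<zero>\<^bsub>quotient_algebra A I\<^esub> = I +> \<zero>"
    by (simp add: quotient_algebra_def FactRing_def a_rcos_const)
  have eq: "I +> x = I +> y \<longleftrightarrow> x \<ominus> y \<in> I" if "x \<in> carrier A" "y \<in> carrier A" for x y
    using quotient_eq_iff_same_a_r_cos[OF ideal_axioms that] by simp
  then show "\<lbrakk>x \<in> carrier A; y \<in> carrier A\<rbrakk> \<Longrightarrow> I +> x = I +> y \<longleftrightarrow> x \<ominus> y \<in> I" .
  \<comment> \<open>Scalars and operators of the quotient are unions over all representatives. When
    \<open>h\<close> respects cosets, every representative contributes the same coset, so the union
    collapses.\<close>
  have union: "(\<Union>f\<in>I +> x. I +> h f) = I +> h x"
    if x: "x \<in> carrier A" and h: "\<And>y. y \<in> carrier A \<Longrightarrow> I +> x = I +> y \<Longrightarrow> I +> h y = I +> h x" for x h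
  proof -
    have "I +> h y = I +> h x" if "y \<in> I +> x" for y
      using that x h a_repr_independence'[OF that x] a_elemrcos_carrier[OF x that] by blast
    then show ?thesis using a_rcos_self[OF x] by blast
  qed
  \<comment> \<open>An additive \<open>h\<close> that preserves \<open>I\<close> respects cosets,
    since \<open>h y\<close> and \<open>h x\<close> differ by the image of an element of
    \<open>I\<close>.\<close>
  have lin: "I +> h y = I +> h x"
    if "x \<in> carrier A" "y \<in> carrier A" "I +> x = I +> y"
      and h: "\<And>z. z \<in> carrier A \<Longrightarrow> h z \<in> carrier A" "\<And>z w. z \<in> carrier A \<Longrightarrow> w \<in> carrier A \<Longrightarrow> h (z \<oplus> w) = h z \<oplus> h w"
        "\<And>z. z \<in> I \<Longrightarrow> h z \<in> I" for x y h
  proof -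
    have "y \<ominus> x \<in> I" using that eq by metis
    then have i: "h (y \<ominus> x) \<in> I" by (rule h)
    have "h y = h (y \<ominus> x) \<oplus> h x"
      using that h(2)[of "y \<ominus> x" x] by (simp add: a_minus_def a_assoc l_neg)
    moreover have "(a \<oplus> b) \<ominus> b = a" if "a \<in> carrier A" "b \<in> carrier A" for a b
      using that by (simp add: a_minus_def a_assoc r_neg)
    ultimately have "h y \<ominus> h x = h (y \<ominus> x)"
      using that by simp
    with i eq that show ?thesis by simp
  qed
  show hom: "(+>) I \<in> operated_hom A (quotient_algebra A I)"
  proof (rule operated_homI)
    fix c x assume x: "x \<in> carrier A"
    have "I +> (c \<odot> y) = I +> (c \<odot> x)" if "y \<in> carrier A" "I +> x = I +> y" for y
      by (rule lin[OF x that]) (use M.smult_closed[of c] M.smult_r_distr[of c] operated_ideal_smult[OF assms, of _ c] in auto)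
    then show "I +> (c \<odot> x) = c \<odot>\<^bsub>quotient_algebra A I\<^esub> (I +> x)"
      unfolding quotient_algebra_def by (simp add: union[OF x])
  next
    fix \<omega> x assume x: "x \<in> carrier A"
    have "I +> oper A \<omega> y = I +> oper A \<omega> x" if "y \<in> carrier A" "I +> x = I +> y" for y
      by (rule lin[OF x that]) (use assms in \<open>auto simp: oper_closed oper_add operated_ideal_def\<close>)
    then show "I +> oper A \<omega> x = oper (quotient_algebra A I) \<omega> (I +> x)"
      unfolding quotient_algebra_def by (simp add: union[OF x])
  qed (auto simp: quotient_algebra_def FactRing_simps rcoset_mult_add a_rcos_sum)
  show "operated_algebra (quotient_algebra A I)"
    by (rule operated_algebra_image[OF carrier hom zero[symmetric]])
qed

end

section \<open>Evaluation of bracketed words\<close>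

text \<open>Names the sum occurring in \<open>is_basis\<close>. With \<open>b\<close> an evaluation
  of words, the same expression is the linear extension of that evaluation.\<close>

definition lin_comb :: "('k::comm_ring_1, 'a, 'm) module_scheme \<Rightarrow> ('i \<Rightarrow> 'a) \<Rightarrow> ('i \<Rightarrow>\<^sub>0 'k) \<Rightarrow> 'a" where
  "lin_comb M b c = (\<Oplus>\<^bsub>M\<^esub>i\<in>keys c. lookup c i \<odot>\<^bsub>M\<^esub> b i)"

primrec eval_prime :: "('k, 'a, 'w) operated_algebra \<Rightarrow> ('x \<Rightarrow> 'a) \<Rightarrow> ('x, 'w) bprime \<Rightarrow> 'a" where
  "eval_prime A f (Letter x) = f x"
| "eval_prime A f (Bracket \<omega> u) = oper A \<omega> (foldr (monoid.mult A) (map (eval_prime A f) u) (one A))"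

definition eval_word :: "('k, 'a, 'w) operated_algebra \<Rightarrow> ('x \<Rightarrow> 'a) \<Rightarrow> ('x, 'w) bword \<Rightarrow> 'a" where
  "eval_word A f u = foldr (monoid.mult A) (map (eval_prime A f) u) (one A)"

lemma eval_word_simps [simp]:
  "eval_word A f [] = \<one>\<^bsub>A\<^esub>"
  "eval_word A f (Letter x # w) = f x \<otimes>\<^bsub>A\<^esub> eval_word A f w"
  "eval_word A f (Bracket \<omega> u # w) = oper A \<omega> (eval_word A f u) \<otimes>\<^bsub>A\<^esub> eval_word A f w"
  by (simp_all add: eval_word_def)

lemma bword_algebra_simps [simp]:
  "carrier (bword_algebra X) = {f. keys f \<subseteq> bwords X}"
  "monoid.mult (bword_algebra X) = (*)"
  "one (bword_algebra X) = 1"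
  "ring.zero (bword_algebra X) = 0"
  "add (bword_algebra X) = (+)"
  "module.smult (bword_algebra X) = scale"
  "oper (bword_algebra X) = brk"
  by (simp_all add: bword_algebra_def)

lemma keys_add_subset: "keys f \<subseteq> W \<Longrightarrow> keys g \<subseteq> W \<Longrightarrow> keys (f + g) \<subseteq> W"
  using keys_add[of f g] by blast

lemma keys_diff_subset: "keys f \<subseteq> W \<Longrightarrow> keys g \<subseteq> W \<Longrightarrow> keys (f - g) \<subseteq> W"
  using keys_diff[of f g] by blast

lemma keys_scale_subset: "keys f \<subseteq> W \<Longrightarrow> keys (scale c f) \<subseteq> W"
  using keys_scale[of c f] by blast

lemma keys_mult_bwords:
  "keys f \<subseteq> bwords X \<Longrightarrow> keys g \<subseteq> bwords X \<Longrightarrow> keys (f * g) \<subseteq> bwords X"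
  using keys_mult[of f g] by fastforce

lemma keys_brk_bwords: "keys f \<subseteq> bwords X \<Longrightarrow> keys (brk \<omega> f) \<subseteq> bwords X"
  using keys_linear_ext[of "\<lambda>w. [Bracket \<omega> w]" f] by fastforce

lemmas keys_intros = keys_add_subset keys_diff_subset keys_scale_subset keys_mult_bwords keys_brk_bwords

lemma operated_algebra_bword_algebra: "operated_algebra (bword_algebra X :: ('k::comm_ring_1, _, 'w) operated_algebra)"
proof (rule operated_algebraI; unfold bword_algebra_simps mem_Collect_eq)
  fix x :: "('a, 'w) bword \<Rightarrow>\<^sub>0 'k" assume "keys x \<subseteq> bwords X"
  then show "\<exists>y\<in>{f. keys f \<subseteq> bwords X}. y + x = 0"
    by (intro bexI[of _ "scale (- 1) x"]) (simp_all add: keys_intros scale_uminus)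
qed (simp_all add: keys_intros algebra_simps scale_add scale_add_left scale_scale scale_mult_left scale_mult_right
  linear_ext_add linear_ext_scale zero_list_def)

lemma (in operated_algebra) smult_zero_left: "x \<in> carrier A \<Longrightarrow> 0 \<odot> x = \<zero>"
  using module.smult_l_null[OF is_module] by simp

lemma (in operated_algebra) smult_closed: "x \<in> carrier A \<Longrightarrow> c \<odot> x \<in> carrier A"
  using module.smult_closed[OF is_module] by simp

lemma (in operated_algebra) smult_add_left: "x \<in> carrier A \<Longrightarrow> (c + d) \<odot> x = c \<odot> x \<oplus> d \<odot> x"
  using module.smult_l_distr[OF is_module, of c d x] by simp

lemma (in operated_algebra) smult_add_right:
  "x \<in> carrier A \<Longrightarrow> y \<in> carrier A \<Longrightarrow> c \<odot> (x \<oplus> y) = c \<odot> x \<oplus> c \<odot> y"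
  using module.smult_r_distr[OF is_module, of c x y] by simp

lemma (in operated_algebra) smult_smult: "x \<in> carrier A \<Longrightarrow> c \<odot> (d \<odot> x) = (c * d) \<odot> x"
  using module.smult_assoc1[OF is_module, of c d x] by simp

lemma (in operated_algebra) smult_one: "x \<in> carrier A \<Longrightarrow> 1 \<odot> x = x"
  using module.smult_one[OF is_module, of x] by simp

context operated_algebra
begin

interpretation ring A by (rule is_ring)

lemma lin_comb_superset:
  assumes "finite K" "keys c \<subseteq> K" "b \<in> K \<rightarrow> carrier A"
  shows "lin_comb A b c = (\<Oplus>i\<in>K. lookup c i \<odot> b i)"
  unfolding lin_comb_def using assms
  by (intro add.finprod_mono_neutral_cong_left)
    (auto simp: in_keys_iff smult_zero_left smult_closed Pi_iff)

lemma lin_comb_closed: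
  assumes "b \<in> W \<rightarrow> carrier A" "keys c \<subseteq> W"
  shows "lin_comb A b c \<in> carrier A"
  unfolding lin_comb_def using assms by (intro add.finprod_closed) (auto intro!: smult_closed)

lemma lin_comb_zero [simp]: "lin_comb A b 0 = \<zero>"
  by (simp add: lin_comb_def)

lemma lin_comb_monomial:
  assumes "b i \<in> carrier A"
  shows "lin_comb A b (monomial i) = b i"
  using assms by (simp add: lin_comb_def lookup_monomial smult_one)

lemma lin_comb_add:
  assumes "b \<in> W \<rightarrow> carrier A" "keys c \<subseteq> W" "keys d \<subseteq> W"
  shows "lin_comb A b (c + d) = lin_comb A b c \<oplus> lin_comb A b d"
proof -
  let ?K = "keys c \<union> keys d"
  have b: "b \<in> ?K \<rightarrow> carrier A" using assms by blast
  then have cl: "(\<lambda>i. lookup e i \<odot> b i) \<in> ?K \<rightarrow> carrier A" for e by (auto intro!: smult_closed)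
  have "lin_comb A b (c + d) = (\<Oplus>i\<in>?K. lookup c i \<odot> b i \<oplus> lookup d i \<odot> b i)"
    unfolding lin_comb_superset[OF _ keys_add b, simplified] using b cl
    by (intro add.finprod_cong') (auto simp: lookup_add intro!: smult_add_left)
  also have "\<dots> = lin_comb A b c \<oplus> lin_comb A b d"
    using cl b by (subst add.finprod_multf) (auto simp: lin_comb_superset[of ?K])
  finally show ?thesis .
qed

lemma lin_comb_scale:
  assumes "b \<in> W \<rightarrow> carrier A" "keys c \<subseteq> W"
  shows "lin_comb A b (scale e c) = e \<odot> lin_comb A b c"
  using assms(2)
proof (induction c rule: linear_induct)
  case zero
  show ?case using smult_smult[of \<zero> e 0] by (simp add: smult_zero_left)
next
  case (add c d)
  then show ?case
    using assms(1) by (simp add: scale_add lin_comb_add[of b W] keys_intros smult_add_right lin_comb_closed)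
next
  case (monomial d w)
  have *: "lin_comb A b (scale a (monomial w)) = a \<odot> b w" for a
    using monomial assms(1) lin_comb_superset[of "{w}" "scale a (monomial w)" b] keys_scale[of a "monomial w"]
    by (auto simp: lookup_monomial smult_closed)
  show ?case
    unfolding scale_scale * by (rule smult_smult[symmetric]) (use monomial assms(1) in blast)
qed

lemma eval_word_closed: "f \<in> X \<rightarrow> carrier A \<Longrightarrow> u \<in> bwords X \<Longrightarrow> eval_word A f u \<in> carrier A"
  by (induction u rule: bword_induct) (auto simp: oper_closed)

lemma eval_word_append:
  "f \<in> X \<rightarrow> carrier A \<Longrightarrow> u \<in> bwords X \<Longrightarrow> v \<in> bwords X \<Longrightarrow>
    eval_word A f (u @ v) = eval_word A f u \<otimes> eval_word A f v"
  by (induction u rule: bword_induct) (auto simp: oper_closed eval_word_closed m_assoc funcset_mem[of f X])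

text \<open>The existence half of freeness of the word algebra among operated algebras.
  Multiplicativity is bilinear in \<open>p\<close> and \<open>q\<close>, hence reduces to
  \<open>eval_word_append\<close>.\<close>

theorem eval_hom:
  fixes f :: "'x \<Rightarrow> 'a"
  assumes f: "f \<in> X \<rightarrow> carrier A"
  shows "lin_comb A (eval_word A f) \<in> operated_hom (bword_algebra X) A"
proof -
  let ?e = "eval_word A f" and ?L = "lin_comb A (eval_word A f)"
  have e: "?e \<in> bwords X \<rightarrow> carrier A" using eval_word_closed[OF f] by blast
  note lin = lin_comb_add[OF e] lin_comb_scale[OF e] lin_comb_closed[OF e] keys_intros
  have mon: "?L (monomial w) = ?e w" if "w \<in> bwords X" for w
    using that by (intro lin_comb_monomial eval_word_closed[OF f])
  show ?thesis
  proof (rule operated_homI)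
    fix p q :: "('x, 'w) bword \<Rightarrow>\<^sub>0 'k"
    assume "p \<in> carrier (bword_algebra X)" "q \<in> carrier (bword_algebra X)"
    then have pq: "keys p \<subseteq> bwords X" "keys q \<subseteq> bwords X" by simp_all
    from pq(1) have "?L (p * q) = ?L p \<otimes> ?L q"
    proof (induction p rule: linear_induct)
      case zero
      then show ?case using pq by (simp add: lin)
    next
      case (add p p')
      then show ?case using pq by (simp add: lin distrib_right l_distr)
    next
      case (monomial c u)
      from pq(2) show ?case
      proof (induction q rule: linear_induct)
        case zero
        then show ?case using monomial by (simp add: lin mon smult_closed eval_word_closed[OF f])
      next
        case (add q q')
        then show ?case
          using monomial by (simp add: lin distrib_left r_distr mon smult_closed eval_word_closed[OF f])
      next
        case (monomial d v)
        with \<open>u \<in> bwords X\<close> show ?case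
          by (simp add: lin scale_mult_left scale_mult_right smult_mult_left smult_mult_right smult_closed
              mon eval_word_closed[OF f] eval_word_append[OF f] flip: monomial_append)
      qed
    qed
    then show "?L (p \<otimes>\<^bsub>bword_algebra X\<^esub> q) = ?L p \<otimes> ?L q" by simp
  next
    fix \<omega> and p :: "('x, 'w) bword \<Rightarrow>\<^sub>0 'k"
    assume "p \<in> carrier (bword_algebra X)"
    then have "keys p \<subseteq> bwords X" by simp
    then have "?L (brk \<omega> p) = oper A \<omega> (?L p)"
    proof (induction p rule: linear_induct)
      case zero
      then show ?case by (simp add: oper_zero)
    next
      case (add p q)
      then show ?case by (simp add: lin linear_ext_add oper_add)
    next
      case (monomial c u)
      then show ?case
        by (simp add: lin linear_ext_scale oper_smult oper_closed mon eval_word_closed[OF f])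
    qed
    then show "?L (oper (bword_algebra X) \<omega> p) = oper A \<omega> (?L p)" by simp
  qed (use mon[of "[]"] in \<open>auto simp: lin\<close>)
qed

end

section \<open>The free Rota-Baxter algebra\<close>

text \<open>The relation with arbitrary elements as contents. The quotient must satisfy the identity
  for classes of all elements, and bilinearity in \<open>f\<close> and \<open>g\<close> brings this
  back to the generating relations on words.\<close>

definition RB_relation ::
  "'w four_ops \<Rightarrow> 'w \<Rightarrow> 'w \<Rightarrow> (('x, 'w) bword \<Rightarrow>\<^sub>0 'k::comm_ring_1) \<Rightarrow> (('x, 'w) bword \<Rightarrow>\<^sub>0 'k) \<Rightarrow> ('x, 'w) bword \<Rightarrow>\<^sub>0 'k" where
  "RB_relation Om \<alpha> \<beta> f g = brk \<alpha> f * brk \<beta> g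
     - brk (\<alpha> \<^bold>\<rightarrow>\<^bsub>Om\<^esub> \<beta>) (brk (\<alpha> \<^bold>\<rhd>\<^bsub>Om\<^esub> \<beta>) f * g)
     - brk (\<alpha> \<^bold>\<leftarrow>\<^bsub>Om\<^esub> \<beta>) (f * brk (\<alpha> \<^bold>\<lhd>\<^bsub>Om\<^esub> \<beta>) g)"

lemma RB_relation_linear:
  "RB_relation Om \<alpha> \<beta> (f + f') g = RB_relation Om \<alpha> \<beta> f g + RB_relation Om \<alpha> \<beta> f' g"
  "RB_relation Om \<alpha> \<beta> f (g + g') = RB_relation Om \<alpha> \<beta> f g + RB_relation Om \<alpha> \<beta> f g'"
  "RB_relation Om \<alpha> \<beta> (scale c f) g = scale c (RB_relation Om \<alpha> \<beta> f g)"
  "RB_relation Om \<alpha> \<beta> f (scale c g) = scale c (RB_relation Om \<alpha> \<beta> f g)"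
  by (simp_all add: RB_relation_def linear_ext_add linear_ext_scale scale_mult_left scale_mult_right
      scale_diff scale_add algebra_simps)

lemma RB_relation_zero [simp]: "RB_relation Om \<alpha> \<beta> 0 g = 0" "RB_relation Om \<alpha> \<beta> f 0 = 0"
  by (simp_all add: RB_relation_def)

lemma RB_relation_monomial:
  "RB_relation Om \<alpha> \<beta> (monomial u) (monomial v) =
      monomial ([Bracket \<alpha> u] @ [Bracket \<beta> v])
      - monomial [Bracket (\<alpha> \<^bold>\<rightarrow>\<^bsub>Om\<^esub> \<beta>) ([Bracket (\<alpha> \<^bold>\<rhd>\<^bsub>Om\<^esub> \<beta>) u] @ v)]
      - monomial [Bracket (\<alpha> \<^bold>\<leftarrow>\<^bsub>Om\<^esub> \<beta>) (u @ [Bracket (\<alpha> \<^bold>\<lhd>\<^bsub>Om\<^esub> \<beta>) v])]"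
  by (simp add: RB_relation_def flip: monomial_append)

lemma RB_relations_altdef:
  "RB_relations Om X = {RB_relation Om \<alpha> \<beta> (monomial u) (monomial v) | u v \<alpha> \<beta>. u \<in> bwords X \<and> v \<in> bwords X}"
  unfolding RB_relations_def RB_relation_monomial ..

lemma keys_RB_relation:
  "keys f \<subseteq> bwords X \<Longrightarrow> keys g \<subseteq> bwords X \<Longrightarrow> keys (RB_relation Om \<alpha> \<beta> f g) \<subseteq> bwords X"
  by (simp add: RB_relation_def keys_intros)

lemma RB_relations_subset: "RB_relations Om X \<subseteq> carrier (bword_algebra X)"
proof
  fix s assume "s \<in> RB_relations Om X"
  then obtain u v \<alpha> \<beta> where "s = RB_relation Om \<alpha> \<beta> (monomial u) (monomial v)" "u \<in> bwords X" "v \<in> bwords X"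
    by (auto simp: RB_relations_altdef)
  then show "s \<in> carrier (bword_algebra X)" by (simp add: keys_RB_relation)
qed

definition RB_ideal :: "'w four_ops \<Rightarrow> 'x set \<Rightarrow> (('x, 'w) bword \<Rightarrow>\<^sub>0 'k::comm_ring_1) set" where
  "RB_ideal Om X = gen_operated_ideal (bword_algebra X) (RB_relations Om X)"

lemma operated_ideal_RB_ideal: "operated_ideal (RB_ideal Om X) (bword_algebra X)"
  unfolding RB_ideal_def
  by (rule operated_algebra.gen_operated_ideal[OF operated_algebra_bword_algebra RB_relations_subset])

lemma RB_relations_subset_RB_ideal: "RB_relations Om X \<subseteq> RB_ideal Om X"
  unfolding RB_ideal_def
  by (rule operated_algebra.gen_operated_ideal[OF operated_algebra_bword_algebra RB_relations_subset])

lemma bword_algebra_minus: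
  fixes f g :: "('x, 'w) bword \<Rightarrow>\<^sub>0 'k::comm_ring_1"
  assumes "keys f \<subseteq> bwords X" "keys g \<subseteq> bwords X"
  shows "f \<ominus>\<^bsub>bword_algebra X\<^esub> g = f - g"
proof -
  interpret ring "bword_algebra X :: ('k, ('x, 'w) bword \<Rightarrow>\<^sub>0 'k, 'w) operated_algebra"
    by (rule operated_algebra.is_ring[OF operated_algebra_bword_algebra])
  have "\<ominus>\<^bsub>bword_algebra X\<^esub> g = - g"
    using assms keys_scale_subset[of g "bwords X" "- 1"]
    by (intro minus_equality) (simp_all add: scale_uminus)
  then show ?thesis by (simp add: a_minus_def)
qed

context
  fixes I :: "(('x, 'w) bword \<Rightarrow>\<^sub>0 'k::comm_ring_1) set" and X :: "'x set"
  assumes I: "operated_ideal I (bword_algebra X)"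
begin

interpretation operated_algebra "bword_algebra X :: ('k, ('x, 'w) bword \<Rightarrow>\<^sub>0 'k, 'w) operated_algebra"
  by (rule operated_algebra_bword_algebra)

interpretation ideal I "bword_algebra X"
  using I by (simp add: operated_ideal_def)

lemma operated_ideal_bword_algebraD:
  shows "0 \<in> I"
    and "f \<in> I \<Longrightarrow> g \<in> I \<Longrightarrow> f + g \<in> I"
    and "f \<in> I \<Longrightarrow> scale c f \<in> I"
    and "f \<in> I \<Longrightarrow> g \<in> I \<Longrightarrow> f - g \<in> I"
    and "f \<in> I \<Longrightarrow> keys h \<subseteq> bwords X \<Longrightarrow> h * f \<in> I"
    and "f \<in> I \<Longrightarrow> keys h \<subseteq> bwords X \<Longrightarrow> f * h \<in> I"
    and "f \<in> I \<Longrightarrow> brk \<omega> f \<in> I"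
    and "f \<in> I \<Longrightarrow> keys f \<subseteq> bwords X"
proof -
  show add: "f \<in> I \<Longrightarrow> g \<in> I \<Longrightarrow> f + g \<in> I" for f g
    using additive_subgroup.a_closed[OF additive_subgroup_axioms, of f g] by simp
  show scale: "f \<in> I \<Longrightarrow> scale c f \<in> I" for f c
    using operated_ideal_smult[OF I, of f c] by simp
  show "f \<in> I \<Longrightarrow> g \<in> I \<Longrightarrow> f - g \<in> I"
    using add[of f "scale (- 1) g"] scale[of g "- 1"] by (simp add: scale_uminus)
  show "0 \<in> I" using additive_subgroup.zero_closed[OF additive_subgroup_axioms] by simp
  show "f \<in> I \<Longrightarrow> keys h \<subseteq> bwords X \<Longrightarrow> h * f \<in> I" using I_l_closed by simp
  show "f \<in> I \<Longrightarrow> keys h \<subseteq> bwords X \<Longrightarrow> f * h \<in> I" using I_r_closed by simp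
  show "f \<in> I \<Longrightarrow> brk \<omega> f \<in> I" using I by (auto simp: operated_ideal_def)
  show "f \<in> I \<Longrightarrow> keys f \<subseteq> bwords X" using Icarr by auto
qed

lemma coset_eq_iff:
  assumes "keys f \<subseteq> bwords X" "keys g \<subseteq> bwords X"
  shows "I +>\<^bsub>bword_algebra X\<^esub> f = I +>\<^bsub>bword_algebra X\<^esub> g \<longleftrightarrow> f - g \<in> I"
  using quotient_algebra_simps(3)[OF I, of f g] assms by (simp add: bword_algebra_minus)

lemma lin_comb_coset:
  assumes "keys c \<subseteq> bwords X"
  shows "lin_comb (quotient_algebra (bword_algebra X) I) (\<lambda>w. I +>\<^bsub>bword_algebra X\<^esub> monomial w) c =
    I +>\<^bsub>bword_algebra X\<^esub> c"
proof -
  let ?Q = "quotient_algebra (bword_algebra X) I" and ?c = "\<lambda>f. I +>\<^bsub>bword_algebra X\<^esub> f"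
  interpret Q: operated_algebra ?Q by (rule quotient_algebra_simps(5)[OF I])
  have hom: "?c \<in> operated_hom (bword_algebra X) ?Q" by (rule quotient_algebra_simps(4)[OF I])
  have b: "(\<lambda>w. ?c (monomial w)) \<in> bwords X \<rightarrow> carrier ?Q"
    by (auto simp: quotient_algebra_simps(1)[OF I])
  show ?thesis
    using assms
  proof (induction c rule: linear_induct)
    case zero
    show ?case using quotient_algebra_simps(2)[OF I] by simp
  next
    case (add f g)
    then show ?case using operated_homD(3)[OF hom, of f g] by (simp add: Q.lin_comb_add[OF b])
  next
    case (monomial c w)
    then show ?case
      using operated_homD(4)[OF hom, of "monomial w" c] b
      by (simp add: Q.lin_comb_scale[OF b] Q.lin_comb_monomial Pi_iff)
  qed
qed

end

lemma RB_relation_in_RB_ideal: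
  fixes f g :: "('x, 'w) bword \<Rightarrow>\<^sub>0 'k::comm_ring_1"
  assumes "keys f \<subseteq> bwords X" "keys g \<subseteq> bwords X"
  shows "RB_relation Om \<alpha> \<beta> f g \<in> RB_ideal Om X"
  using assms(1)
proof (induction f rule: linear_induct)
  case (monomial c u)
  from assms(2) show ?case
  proof (induction g rule: linear_induct)
    case (monomial d v)
    with \<open>u \<in> bwords X\<close> have "RB_relation Om \<alpha> \<beta> (Defs.monomial u) (Defs.monomial v) \<in> (RB_ideal Om X :: (_ \<Rightarrow>\<^sub>0 'k) set)"
      by (intro subsetD[OF RB_relations_subset_RB_ideal]) (auto simp: RB_relations_altdef)
    then show ?case
      by (simp add: RB_relation_linear operated_ideal_bword_algebraD[OF operated_ideal_RB_ideal])
  qed (simp_all add: RB_relation_linear operated_ideal_bword_algebraD[OF operated_ideal_RB_ideal])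
qed (simp_all add: RB_relation_linear operated_ideal_bword_algebraD[OF operated_ideal_RB_ideal])

lemma Omega_RB_algebra_quotient:
  "Omega_RB_algebra Om (quotient_algebra (bword_algebra X) (RB_ideal Om X :: (('x, 'w) bword \<Rightarrow>\<^sub>0 'k::comm_ring_1) set))"
    (is "Omega_RB_algebra Om ?Q")
proof -
  let ?c = "\<lambda>f :: ('x, 'w) bword \<Rightarrow>\<^sub>0 'k. RB_ideal Om X +>\<^bsub>bword_algebra X\<^esub> f"
  interpret operated_algebra "bword_algebra X :: ('k, ('x, 'w) bword \<Rightarrow>\<^sub>0 'k, 'w) operated_algebra"
    by (rule operated_algebra_bword_algebra)
  note quot = quotient_algebra_simps[OF operated_ideal_RB_ideal]
  interpret Q: operated_algebra ?Q by (rule quot(5))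
  have hom: "?c \<in> operated_hom (bword_algebra X) ?Q" by (rule quot(4))
  show ?thesis
  proof
    fix \<alpha> \<beta> a b assume "a \<in> carrier ?Q" "b \<in> carrier ?Q"
    then obtain f g where fg: "keys f \<subseteq> bwords X" "keys g \<subseteq> bwords X" "a = ?c f" "b = ?c g"
      by (auto simp: quot(1))
    have "?c (brk \<alpha> f * brk \<beta> g) =
        ?c (brk (\<alpha> \<^bold>\<rightarrow>\<^bsub>Om\<^esub> \<beta>) (brk (\<alpha> \<^bold>\<rhd>\<^bsub>Om\<^esub> \<beta>) f * g) + brk (\<alpha> \<^bold>\<leftarrow>\<^bsub>Om\<^esub> \<beta>) (f * brk (\<alpha> \<^bold>\<lhd>\<^bsub>Om\<^esub> \<beta>) g))"
      using fg RB_relation_in_RB_ideal[OF fg(1,2), of Om \<alpha> \<beta>]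
      by (subst coset_eq_iff[OF operated_ideal_RB_ideal]) (simp_all add: keys_intros RB_relation_def diff_diff_eq)
    then show "oper ?Q \<alpha> a \<otimes>\<^bsub>?Q\<^esub> oper ?Q \<beta> b =
        oper ?Q (\<alpha> \<^bold>\<rightarrow>\<^bsub>Om\<^esub> \<beta>) (oper ?Q (\<alpha> \<^bold>\<rhd>\<^bsub>Om\<^esub> \<beta>) a \<otimes>\<^bsub>?Q\<^esub> b) \<oplus>\<^bsub>?Q\<^esub>
        oper ?Q (\<alpha> \<^bold>\<leftarrow>\<^bsub>Om\<^esub> \<beta>) (a \<otimes>\<^bsub>?Q\<^esub> oper ?Q (\<alpha> \<^bold>\<lhd>\<^bsub>Om\<^esub> \<beta>) b)"
      using fg(1,2) unfolding fg(3,4)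
      by (simp add: keys_intros operated_homD(2-)[OF hom, symmetric, simplified])
  qed
qed

text \<open>The Rota-Baxter identity of \<open>A\<close> sends each generating relation to zero, and
  the kernel of the evaluation is an operated ideal.\<close>

lemma (in Omega_RB_algebra) eval_RB_ideal:
  fixes X :: "'x set"
  assumes f: "f \<in> X \<rightarrow> carrier A" and p: "p \<in> RB_ideal Om X"
  shows "lin_comb A (eval_word A f) p = \<zero>"
proof -
  let ?L = "lin_comb A (eval_word A f)"
  interpret ring A by (rule is_ring)
  have hom: "?L \<in> operated_hom (bword_algebra X) A" by (rule eval_hom[OF f])
  have "?L s = \<zero>" if "s \<in> RB_relations Om X" for s
  proof -
    from that obtain \<alpha> \<beta> u v where uv: "u \<in> bwords X" "v \<in> bwords X"
      and s: "s = RB_relation Om \<alpha> \<beta> (monomial u) (monomial v)"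
      by (auto simp: RB_relations_altdef)
    define a b :: "('x, 'w) bword \<Rightarrow>\<^sub>0 'k" where "a = brk \<alpha> (monomial u) * brk \<beta> (monomial v)"
      and "b = brk (\<alpha> \<^bold>\<rightarrow>\<^bsub>Om\<^esub> \<beta>) (brk (\<alpha> \<^bold>\<rhd>\<^bsub>Om\<^esub> \<beta>) (monomial u) * monomial v)
             + brk (\<alpha> \<^bold>\<leftarrow>\<^bsub>Om\<^esub> \<beta>) (monomial u * brk (\<alpha> \<^bold>\<lhd>\<^bsub>Om\<^esub> \<beta>) (monomial v))"
    have keys: "keys (monomial w :: _ \<Rightarrow>\<^sub>0 'k) \<subseteq> bwords X" if "w \<in> bwords X" for w :: "('x, 'w) bword"
      using that by simp
    have ab: "keys a \<subseteq> bwords X" "keys b \<subseteq> bwords X"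
      unfolding a_def b_def by (intro keys_intros keys uv)+
    \<comment> \<open>Written additively, because homomorphisms are known to respect sums;
      cancellation in \<open>A\<close> then gives the value zero.\<close>
    have s: "b + s = a" by (simp add: s a_def b_def RB_relation_def)
    have "keys s \<subseteq> bwords X" using RB_relations_subset that by auto
    then have "?L a = ?L b \<oplus> ?L s"
      using ab operated_homD(3)[OF hom, of b s] by (simp add: s)
    moreover have "?L a = ?L b"
    proof -
      note h = operated_homD(2-)[OF hom, simplified]
      have m: "?L (monomial w) \<in> carrier A" if "w \<in> bwords X" for w
        using that operated_homD(1)[OF hom, of "monomial w"] by simp
      have "?L a = oper A \<alpha> (?L (monomial u)) \<otimes> oper A \<beta> (?L (monomial v))"
        using uv by (simp add: a_def h keys_intros del: linear_ext_monomial)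
      also note rota_baxter[OF m[OF uv(1)] m[OF uv(2)]]
      also have "oper A (\<alpha> \<^bold>\<rightarrow>\<^bsub>Om\<^esub> \<beta>) (oper A (\<alpha> \<^bold>\<rhd>\<^bsub>Om\<^esub> \<beta>) (?L (monomial u)) \<otimes> ?L (monomial v))
          \<oplus> oper A (\<alpha> \<^bold>\<leftarrow>\<^bsub>Om\<^esub> \<beta>) (?L (monomial u) \<otimes> oper A (\<alpha> \<^bold>\<lhd>\<^bsub>Om\<^esub> \<beta>) (?L (monomial v))) = ?L b"
        using uv by (simp add: b_def h keys_intros del: linear_ext_monomial)
      finally show ?thesis .
    qed
    moreover have "?L b \<in> carrier A" "?L s \<in> carrier A"
      using ab \<open>keys s \<subseteq> bwords X\<close> operated_homD(1)[OF hom] by auto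
    ultimately show ?thesis using add.l_cancel_one[of "?L b" "?L s"] by simp
  qed
  then show ?thesis
    using operated_algebra.gen_operated_ideal_subset_kernel[OF operated_algebra_bword_algebra operated_algebra_axioms hom RB_relations_subset] p
    unfolding RB_ideal_def by blast
qed

text \<open>Evaluation in the target algebra vanishes on \<open>I\<close> and so descends to the
  quotient. Uniqueness holds because the classes of letters generate the quotient as an operated
  algebra.\<close>

theorem free_Omega_RB_algebra_quotient:
  fixes X :: "'x set" and Om :: "'w four_ops"
  defines "I \<equiv> RB_ideal Om X :: (('x, 'w) bword \<Rightarrow>\<^sub>0 'k::comm_ring_1) set"
  shows "free_Omega_RB_algebra TYPE('a) Om X (\<lambda>x. I +>\<^bsub>bword_algebra X\<^esub> monomial [Letter x])
    (quotient_algebra (bword_algebra X) I)"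
proof -
  let ?Q = "quotient_algebra (bword_algebra X) I"
  let ?c = "\<lambda>f :: ('x, 'w) bword \<Rightarrow>\<^sub>0 'k. I +>\<^bsub>bword_algebra X\<^esub> f"
  have I: "operated_ideal I (bword_algebra X)" unfolding I_def by (rule operated_ideal_RB_ideal)
  note quot = operated_algebra.quotient_algebra_simps[OF operated_algebra_bword_algebra I]
  have chom: "?c \<in> operated_hom (bword_algebra X) ?Q" by (rule quot(4))
  note ch = operated_homD(2-)[OF chom, symmetric, simplified] operated_hom_one[OF chom, symmetric, simplified]
  have Q: "Omega_RB_algebra Om ?Q" unfolding I_def by (rule Omega_RB_algebra_quotient)
  have "\<exists>!\<phi>. \<phi> \<in> operated_hom ?Q A \<and> \<phi> \<in> extensional (carrier ?Q) \<and> (\<forall>x\<in>X. \<phi> (?c (monomial [Letter x])) = f x)"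
    if "Omega_RB_algebra Om A" and f: "f \<in> X \<rightarrow> carrier A" for A :: "('k, 'a, 'w) operated_algebra" and f
  proof -
    interpret Omega_RB_algebra Om A by fact
    interpret ring A by (rule is_ring)
    let ?L = "lin_comb A (eval_word A f) :: (('x, 'w) bword \<Rightarrow>\<^sub>0 'k) \<Rightarrow> 'a"
    have hom: "?L \<in> operated_hom (bword_algebra X) A" by (rule eval_hom[OF f])
    note h = operated_homD[OF hom, simplified] operated_hom_one[OF hom, simplified]
    have wd: "?L p = ?L q" if "keys p \<subseteq> bwords X" "keys q \<subseteq> bwords X" "?c p = ?c q" for p q
    proof -
      have "p - q \<in> I" using coset_eq_iff[OF I that(1,2)] that(3) by simp
      then have "?L (p - q) = \<zero>\<^bsub>A\<^esub>" unfolding I_def by (rule eval_RB_ideal[OF f])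
      moreover have "?L (q + (p - q)) = ?L q \<oplus>\<^bsub>A\<^esub> ?L (p - q)"
        using h(3)[OF that(2) keys_diff_subset[OF that(1,2)]] .
      ultimately show ?thesis using h(1)[OF that(2)] by simp
    qed
    \<comment> \<open>The value is computed at a chosen representative, which is harmless by
      \<open>wd\<close>; restriction makes the map extensional.\<close>
    define \<phi> where "\<phi> = restrict (\<lambda>C. ?L (SOME p. keys p \<subseteq> bwords X \<and> ?c p = C)) (carrier ?Q)"
    have \<phi>: "\<phi> (?c p) = ?L p" if "keys p \<subseteq> bwords X" for p
    proof -
      have "?c p \<in> carrier ?Q" using that by (auto simp: quot(1))
      moreover have "?L (SOME q. keys q \<subseteq> bwords X \<and> ?c q = ?c p) = ?L p"
      proof (rule someI2[of _ p])
        show "keys p \<subseteq> bwords X \<and> ?c p = ?c p" using that by blast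
        show "?L q = ?L p" if "keys q \<subseteq> bwords X \<and> ?c q = ?c p" for q
          using that \<open>keys p \<subseteq> bwords X\<close> by (intro wd) blast+
      qed
      ultimately show ?thesis by (simp add: \<phi>_def)
    qed
    show ?thesis
    proof (rule ex1I[of _ \<phi>], intro conjI ballI)
      show "\<phi> \<in> operated_hom ?Q A"
      proof (rule operated_homI; (unfold quot(1))?; (elim imageE)?; hypsubst?)
      qed (simp_all add: ch h \<phi> keys_intros zero_list_def)
      show "\<phi> \<in> extensional (carrier ?Q)" by (simp add: \<phi>_def)
      show "\<phi> (?c (monomial [Letter x])) = f x" if "x \<in> X" for x
        using that f by (auto simp: \<phi> lin_comb_monomial Pi_iff)
    next
      fix \<psi> assume \<psi>: "\<psi> \<in> operated_hom ?Q A \<and> \<psi> \<in> extensional (carrier ?Q) \<and>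
        (\<forall>x\<in>X. \<psi> (?c (monomial [Letter x])) = f x)"
      have \<psi>hom: "\<psi> \<in> operated_hom ?Q A" using \<psi> by blast
      note ph = operated_homD[OF \<psi>hom] operated_hom_one[OF \<psi>hom]
      have car: "?c p \<in> carrier ?Q" if "keys p \<subseteq> bwords X" for p using that by (auto simp: quot(1))
      have word: "\<psi> (?c (monomial w)) = eval_word A f w" if "w \<in> bwords X" for w
        using that
      proof (induction rule: bwords_induct)
        case Nil
        show ?case using ph(6) ch(5) by simp
      next
        case (Letter x w)
        have "?c (monomial (Letter x # w)) = ?c (monomial [Letter x]) \<otimes>\<^bsub>?Q\<^esub> ?c (monomial w)"
          using Letter by (simp add: ch flip: monomial_append)
        then show ?case using Letter \<psi> ph(2)[OF car car, of "monomial [Letter x]" "monomial w"] by simp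
      next
        case (Bracket \<omega> u w)
        have "?c (monomial (Bracket \<omega> u # w)) = oper ?Q \<omega> (?c (monomial u)) \<otimes>\<^bsub>?Q\<^esub> ?c (monomial w)"
          using Bracket by (simp add: ch flip: monomial_append)
        moreover have "oper ?Q \<omega> (?c (monomial u)) \<in> carrier ?Q"
          using Bracket by (simp add: ch car)
        ultimately show ?case
          using Bracket by (simp add: ph car)
      qed
      have lin: "\<psi> (?c p) = ?L p" if "keys p \<subseteq> bwords X" for p
        using that
      proof (induction rule: linear_induct)
        case zero
        \<comment> \<open>Preservation of zero is obtained by scaling with 0, because
          \<open>operated_hom\<close> does not state it.\<close>
        have "?c 0 = 0 \<odot>\<^bsub>?Q\<^esub> ?c 0" by (simp add: ch)
        then show ?case using ph(4)[OF car, of 0 0] ph(1)[OF car, of 0] by (simp add: smult_zero_left)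
      next
        case (add p q)
        then have "\<psi> (?c (p + q)) = \<psi> (?c p) \<oplus>\<^bsub>A\<^esub> \<psi> (?c q)"
          using ph(3)[OF car car, of p q] by (simp add: ch)
        with add show ?case by (simp add: h)
      next
        case (monomial c w)
        then have "\<psi> (?c (scale c (Defs.monomial w))) = c \<odot>\<^bsub>A\<^esub> \<psi> (?c (Defs.monomial w))"
          using ph(4)[OF car, of "Defs.monomial w" c] by (simp add: ch)
        with monomial show ?case
          using word h(4)[of "Defs.monomial w" c] lin_comb_monomial[of "eval_word A f" w] eval_word_closed[OF f]
          by simp
      qed
      show "\<psi> = \<phi>"
      proof (rule extensionalityI[of _ "carrier ?Q"])
        show "\<psi> \<in> extensional (carrier ?Q)" using \<psi> by blast
        show "\<phi> \<in> extensional (carrier ?Q)" by (simp add: \<phi>_def)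
        fix C assume "C \<in> carrier ?Q"
        then obtain p where "keys p \<subseteq> bwords X" "C = ?c p" by (auto simp: quot(1))
        then show "\<psi> C = \<phi> C" by (simp add: lin \<phi>)
      qed
    qed
  qed
  moreover have "(\<lambda>x. ?c (monomial [Letter x])) \<in> X \<rightarrow> carrier ?Q" by (auto simp: quot(1))
  ultimately show ?thesis unfolding free_Omega_RB_algebra_def using Q by blast
qed

section \<open>Linear independence of reduced words\<close>

definition dia_algebra :: "'w four_ops \<Rightarrow> ('k::comm_ring_1, ('x, 'w) bword \<Rightarrow>\<^sub>0 'k, 'w) operated_algebra" where
  "dia_algebra Om = \<lparr>carrier = UNIV, monoid.mult = dprod Om, one = 1, ring.zero = 0, add = (+),
     module.smult = scale, oper = brk\<rparr>"

lemma dia_algebra_simps [simp]: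
  "carrier (dia_algebra Om) = UNIV"
  "monoid.mult (dia_algebra Om) = dprod Om"
  "one (dia_algebra Om) = 1"
  "ring.zero (dia_algebra Om) = 0"
  "add (dia_algebra Om) = (+)"
  "module.smult (dia_algebra Om) = scale"
  "oper (dia_algebra Om) = brk"
  by (simp_all add: dia_algebra_def)

lemma (in ext_diassociative_semigroup) Omega_RB_algebra_dia_algebra:
  "Omega_RB_algebra Om (dia_algebra Om :: ('k::comm_ring_1, ('x, 'w) bword \<Rightarrow>\<^sub>0 'k, 'w) operated_algebra)"
proof -
  have "operated_algebra (dia_algebra Om :: ('k, ('x, 'w) bword \<Rightarrow>\<^sub>0 'k, 'w) operated_algebra)"
  proof (rule operated_algebraI; unfold dia_algebra_simps)
    show "\<exists>y\<in>UNIV. y + x = 0" for x :: "('x, 'w) bword \<Rightarrow>\<^sub>0 'k"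
      by (intro bexI[of _ "- x"]) simp_all
  qed (simp_all add: dprod_linear scale_add_left scale_scale dprod_assoc add.assoc add.commute)
  then show ?thesis
    by (intro Omega_RB_algebra.intro Omega_RB_algebra_axioms.intro) (simp_all add: dprod_rota_baxter[of Om])
qed

text \<open>The irreducible words with the leading words of the relations written out, so that
  independence can be proved without mentioning an order.\<close>

definition reduced_words :: "'x set \<Rightarrow> ('x, 'w) bword set" where
  "reduced_words X = {w \<in> bwords X. \<forall>q\<in>star_words X. \<forall>\<alpha> \<beta>. \<forall>u\<in>bwords X. \<forall>v\<in>bwords X.
     w \<noteq> plug q [Bracket \<alpha> u, Bracket \<beta> v]}"

lemma reduced_wordsD:
  "w \<in> reduced_words X \<Longrightarrow> q \<in> star_words X \<Longrightarrow> u \<in> bwords X \<Longrightarrow> v \<in> bwords X \<Longrightarrow>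
    plug q [Bracket \<alpha> u, Bracket \<beta> v] \<noteq> w"
  unfolding reduced_words_def by blast

text \<open>A context for a forbidden factor of the tail extends to one for the whole word.
  \<open>reduced_words_Bracket\<close> argues in the same way for the content of a bracket.\<close>

lemma reduced_words_tl:
  assumes "a # w \<in> reduced_words X"
  shows "w \<in> reduced_words X"
proof -
  have a: "[a] \<in> bwords X" "w \<in> bwords X"
    using assms bwords_append[of "[a]" w X] by (auto simp: reduced_words_def)
  have "plug q [Bracket \<alpha> u, Bracket \<beta> v] \<noteq> w"
    if "q \<in> star_words X" "u \<in> bwords X" "v \<in> bwords X" for q \<alpha> \<beta> u v
  proof
    assume w: "plug q [Bracket \<alpha> u, Bracket \<beta> v] = w"
    have "emb [a] @ q \<in> star_words X" using that a by (simp add: star_words_iff)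
    moreover have "plug (emb [a] @ q) [Bracket \<alpha> u, Bracket \<beta> v] = a # w"
      using w by (simp only: plug_simps plug_emb) simp
    ultimately show False
      using reduced_wordsD[OF assms] that by blast
  qed
  with a show ?thesis unfolding reduced_words_def by blast
qed

lemma reduced_words_Bracket:
  assumes "Bracket \<omega> u # w \<in> reduced_words X"
  shows "u \<in> reduced_words X" "w \<noteq> Bracket \<beta> v # w'"
proof -
  have uw: "u \<in> bwords X" "w \<in> bwords X" using assms by (auto simp: reduced_words_def)
  have "plug q [Bracket \<alpha> u', Bracket \<beta> v'] \<noteq> u"
    if "q \<in> star_words X" "u' \<in> bwords X" "v' \<in> bwords X" for q \<alpha> \<beta> u' v'
  proof
    assume "plug q [Bracket \<alpha> u', Bracket \<beta> v'] = u"
    then have "plug (Bracket \<omega> q # emb w) [Bracket \<alpha> u', Bracket \<beta> v'] = Bracket \<omega> u # w" by simp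
    moreover have "Bracket \<omega> q # emb w \<in> star_words X"
      using that uw by (simp add: star_words_iff)
    ultimately show False
      using reduced_wordsD[OF assms] that by blast
  qed
  with uw show "u \<in> reduced_words X" unfolding reduced_words_def by blast
  show "w \<noteq> Bracket \<beta> v # w'"
  proof
    assume w: "w = Bracket \<beta> v # w'"
    then have "plug (Letter None # emb w') [Bracket \<omega> u, Bracket \<beta> v] = Bracket \<omega> u # w" by simp
    moreover have "Letter None # emb w' \<in> star_words X" "v \<in> bwords X"
      using uw w by (simp_all add: star_words_iff)
    ultimately show False
      using reduced_wordsD[OF assms] uw by blast
  qed
qed

text \<open>No two brackets are adjacent in a reduced word, at any depth, so every product met
  during the evaluation is plain concatenation.\<close>

lemma eval_dia_algebra_reduced:
  assumes "w \<in> reduced_words X"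
  shows "eval_word (dia_algebra Om) (\<lambda>x. monomial [Letter x]) w = (monomial w :: _ \<Rightarrow>\<^sub>0 'k::comm_ring_1)"
  using assms
proof (induction w rule: bword_induct)
  case (Letter x w)
  then show ?case
    using reduced_words_tl[OF Letter.prems] by (simp add: dia_Letter_left[of Om "[]", simplified] del: monomial_Nil)
next
  case (Bracket \<omega> u w)
  have "dia Om [Bracket \<omega> u] w = (monomial (Bracket \<omega> u # w) :: _ \<Rightarrow>\<^sub>0 'k)"
  proof (cases w)
    case (Cons a v)
    with reduced_words_Bracket(2)[OF Bracket.prems] obtain x where "a = Letter x" by (cases a) auto
    with Cons show ?thesis by (simp add: dia_Letter_right)
  qed simp
  then show ?case
    using Bracket reduced_words_tl[OF Bracket.prems] reduced_words_Bracket(1)[OF Bracket.prems] by simp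
qed simp

lemma (in ext_diassociative_semigroup) RB_ideal_reduced_eq_0:
  fixes r :: "('x, 'w) bword \<Rightarrow>\<^sub>0 'k::comm_ring_1"
  assumes "r \<in> RB_ideal Om X" "keys r \<subseteq> reduced_words X"
  shows "r = 0"
proof -
  let ?f = "\<lambda>x. monomial [Letter x] :: ('x, 'w) bword \<Rightarrow>\<^sub>0 'k"
  interpret D: Omega_RB_algebra Om "dia_algebra Om :: ('k, ('x, 'w) bword \<Rightarrow>\<^sub>0 'k, 'w) operated_algebra"
    by (rule Omega_RB_algebra_dia_algebra)
  have e: "eval_word (dia_algebra Om) ?f \<in> reduced_words X \<rightarrow> carrier (dia_algebra Om)" by simp
  have "lin_comb (dia_algebra Om) (eval_word (dia_algebra Om) ?f) r = r"
    using assms(2)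
    by (induction r rule: linear_induct)
      (simp_all add: D.lin_comb_add[OF e] D.lin_comb_scale[OF e] D.lin_comb_monomial eval_dia_algebra_reduced)
  moreover have "lin_comb (dia_algebra Om) (eval_word (dia_algebra Om) ?f) r = 0"
    using D.eval_RB_ideal[of ?f X r] assms(1) by simp
  ultimately show ?thesis by simp
qed


section \<open>Reduction\<close>

lemma plug_lin_linear:
  "plug_lin q 0 = 0" "plug_lin q (f + g) = plug_lin q f + plug_lin q g"
  "plug_lin q (scale c f) = scale c (plug_lin q f)" "plug_lin q (monomial w) = monomial (plug q w)"
  by (simp_all add: plug_lin_def linear_ext_add linear_ext_scale)

text \<open>Expresses substitution through the operations of the algebra. This makes operated ideals
  stable under it and presents the two parts of an intersection composition as substitution
  instances.\<close>

lemma plug_lin_star: "plug_lin (emb l @ Letter None # emb r) f = monomial l * f * monomial r"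
  by (induction f rule: linear_induct[OF subset_UNIV])
    (simp_all add: plug_lin_linear distrib_left distrib_right scale_mult_left scale_mult_right flip: monomial_append)

lemma plug_lin_Bracket:
  "plug_lin (emb l @ Bracket \<omega> q # emb r) f = monomial l * brk \<omega> (plug_lin q f) * monomial r"
  by (induction f rule: linear_induct[OF subset_UNIV])
    (simp_all add: plug_lin_linear linear_ext_add linear_ext_scale distrib_left distrib_right
      scale_mult_left scale_mult_right flip: monomial_append)

lemma plug_inj: "q \<in> star_words X \<Longrightarrow> plug q u = plug q v \<longleftrightarrow> u = v"
  by (induction rule: star_words_induct) auto

lemma plug_lin_in_operated_ideal:
  assumes "operated_ideal I (bword_algebra X)" "f \<in> I" "q \<in> star_words X"
  shows "plug_lin q f \<in> I"
  using assms(3)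
  by (induction rule: star_words_induct)
    (simp_all add: plug_lin_star plug_lin_Bracket operated_ideal_bword_algebraD[OF assms(1)] assms(2))

text \<open>The finite nonempty support has a greatest element by linearity, and antisymmetry makes
  the description in \<open>lead\<close> unique.\<close>

lemma lead_greatest:
  assumes "linear_order_on W ord" "keys f \<subseteq> W" "f \<noteq> 0"
  shows "lead ord f \<in> keys f" "v \<in> keys f \<Longrightarrow> (v, lead ord f) \<in> ord"
proof -
  have refl: "refl_on W ord" and trans: "trans ord" and antisym: "antisym ord" and total: "total_on W ord"
    using assms(1) by (auto simp: linear_order_on_def partial_order_on_def preorder_on_def)
  have "\<exists>w\<in>K. \<forall>v\<in>K. (v, w) \<in> ord" if "finite K" "K \<noteq> {}" "K \<subseteq> W" for K
    using that
  proof (induction K rule: finite_ne_induct)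
    case (singleton x)
    then show ?case using refl by (auto simp: refl_on_def)
  next
    case (insert x K)
    then obtain w where w: "w \<in> K" "\<forall>v\<in>K. (v, w) \<in> ord" by auto
    have "(x, w) \<in> ord \<or> (w, x) \<in> ord"
      using insert w total refl unfolding total_on_def refl_on_def by (metis insert_subset subsetD)
    then show ?case
    proof
      assume "(w, x) \<in> ord"
      then have "\<forall>v\<in>insert x K. (v, x) \<in> ord"
        using w insert.prems refl trans unfolding refl_on_def trans_def by blast
      then show ?thesis by blast
    qed (use w in blast)
  qed
  from this[of "keys f"] obtain w where w: "w \<in> keys f" "\<forall>v\<in>keys f. (v, w) \<in> ord"
    using assms by auto
  have "lead ord f = w"
    unfolding lead_def using w antisym unfolding antisym_def by (intro the_equality) blast+
  with w show "lead ord f \<in> keys f" "v \<in> keys f \<Longrightarrow> (v, lead ord f) \<in> ord" by auto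
qed

text \<open>Combinations of substituted relations whose leading words lie in \<open>B\<close>. Zero
  coefficients are allowed, so the set is closed under scaling even when the ring has zero divisors.
  As bounds \<open>B\<close> occur the words up to \<open>w\<close>, those strictly below
  \<open>w\<close>, and \<open>UNIV\<close>.\<close>

inductive_set rspan ::
  "'x set \<Rightarrow> ('x, 'w) bword rel \<Rightarrow> (('x, 'w) bword \<Rightarrow>\<^sub>0 'k::comm_ring_1) set \<Rightarrow> ('x, 'w) bword set \<Rightarrow> (('x, 'w) bword \<Rightarrow>\<^sub>0 'k) set"
  for X ord S B where
  zero: "0 \<in> rspan X ord S B"
| step: "h \<in> rspan X ord S B \<Longrightarrow> q \<in> star_words X \<Longrightarrow> s \<in> S \<Longrightarrow> plug q (lead ord s) \<in> B \<Longrightarrow>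
    h + scale c (plug_lin q s) \<in> rspan X ord S B"

lemma rspan_mono: "h \<in> rspan X ord S B \<Longrightarrow> B \<subseteq> B' \<Longrightarrow> h \<in> rspan X ord S B'"
  by (induction rule: rspan.induct) (auto intro: rspan.intros)

lemma rspan_add: "g \<in> rspan X ord S B \<Longrightarrow> f \<in> rspan X ord S B \<Longrightarrow> f + g \<in> rspan X ord S B"
  by (induction rule: rspan.induct) (auto simp: add.assoc[symmetric] intro: rspan.intros)

lemma rspan_scale: "h \<in> rspan X ord S B \<Longrightarrow> scale c h \<in> rspan X ord S B"
  by (induction rule: rspan.induct) (auto simp: scale_add scale_scale intro: rspan.intros)

lemma rspan_subset_ideal:
  assumes "operated_ideal I (bword_algebra X)" "S \<subseteq> I" "h \<in> rspan X ord S B"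
  shows "h \<in> I"
  using assms(3)
  by (induction rule: rspan.induct)
    (use assms in \<open>auto intro!: operated_ideal_bword_algebraD[OF assms(1)] plug_lin_in_operated_ideal\<close>)

lemma rspan_trivial_mod:
  assumes "h \<in> rspan X ord S {v. (v, w) \<in> ord - Id}"
  shows "trivial_mod X ord S w h"
  using assms
proof (induction rule: rspan.induct)
  case zero
  show ?case unfolding trivial_mod_def by (rule exI[of _ 0]) simp
next
  case (step h p s d)
  show ?case
  \<comment> \<open>\<open>trivial_mod\<close> asks for nonzero coefficients, so a summand with
    coefficient zero is dropped here.\<close>
  proof (cases "d = 0")
    case False
    from step.IH obtain n c q t where h: "h = (\<Sum>i<n. scale (c i) (plug_lin (q i) (t i)))"
      and t: "\<forall>i<n::nat. c i \<noteq> 0 \<and> q i \<in> star_words X \<and> t i \<in> S \<and> (plug (q i) (lead ord (t i)), w) \<in> ord - Id"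
      unfolding trivial_mod_def by blast
    have "h + scale d (plug_lin p s) =
        (\<Sum>i<Suc n. scale ((c(n := d)) i) (plug_lin ((q(n := p)) i) ((t(n := s)) i)))"
      unfolding h by simp
    moreover have "\<forall>i<Suc n. (c(n := d)) i \<noteq> 0 \<and> (q(n := p)) i \<in> star_words X \<and> (t(n := s)) i \<in> S \<and>
        (plug ((q(n := p)) i) (lead ord ((t(n := s)) i)), w) \<in> ord - Id"
      using t step.hyps False by (auto simp: less_Suc_eq)
    ultimately show ?thesis unfolding trivial_mod_def by blast
  qed (use step.IH in simp)
qed

section \<open>Reduction modulo monic relations\<close>

locale monic_relations =
  fixes X :: "'x set" and ord :: "('x, 'w) bword rel" and S :: "(('x, 'w) bword \<Rightarrow>\<^sub>0 'k::comm_ring_1) set"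
  assumes monomial_order: "monomial_order X ord"
    and monic: "\<And>s. s \<in> S \<Longrightarrow> monic ord s"
    and keys_subset: "\<And>s. s \<in> S \<Longrightarrow> keys s \<subseteq> bwords X"
begin

lemma linear_order: "linear_order_on (bwords X) ord"
  and wf_ord: "wf (ord - Id)"
  using monomial_order by (auto simp: monomial_order_def well_order_on_def)

lemma ord_refl: "w \<in> bwords X \<Longrightarrow> (w, w) \<in> ord"
  and ord_trans: "(u, v) \<in> ord \<Longrightarrow> (v, w) \<in> ord \<Longrightarrow> (u, w) \<in> ord"
  and ord_antisym: "(u, v) \<in> ord \<Longrightarrow> (v, u) \<in> ord \<Longrightarrow> u = v"
  using linear_order
  by (auto simp: linear_order_on_def partial_order_on_def preorder_on_def refl_on_def dest: transD antisymD)

lemma keys_plug_lin: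
  assumes "q \<in> star_words X" "s \<in> S"
  shows "keys (plug_lin q s) \<subseteq> bwords X"
  using keys_linear_ext[of "plug q" s] keys_subset[OF assms(2)] plug_in_bwords[OF assms(1)]
  unfolding plug_lin_def by blast

text \<open>Substitution into a star word is injective and strictly monotone on words, so it carries
  the leading word to the leading word and keeps its coefficient.\<close>

lemma plug_lin_lead:
  assumes q: "q \<in> star_words X" and s: "s \<in> S"
  shows "lookup (plug_lin q s) (plug q (lead ord s)) = 1"
    and "v \<in> keys (plug_lin q s) \<Longrightarrow> (v, plug q (lead ord s)) \<in> ord"
proof -
  have ne: "s \<noteq> 0" and one: "lookup s (lead ord s) = 1" using monic[OF s] by (auto simp: monic_def)
  note lead = lead_greatest[OF linear_order keys_subset[OF s] ne]
  have inj: "inj_on (plug q) A" for A :: "('x, 'w) bword set"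
    using plug_inj[OF q] by (auto simp: inj_on_def)
  show "lookup (plug_lin q s) (plug q (lead ord s)) = 1"
    unfolding plug_lin_def by (subst lookup_linear_ext_inj[OF inj]) (rule one)
  show "(v, plug q (lead ord s)) \<in> ord" if v: "v \<in> keys (plug_lin q s)"
  proof -
    from v obtain u where u: "u \<in> keys s" "v = plug q u"
      using keys_linear_ext[of "plug q" s] unfolding plug_lin_def by blast
    have bw: "u \<in> bwords X" "lead ord s \<in> bwords X" using u lead(1) keys_subset[OF s] by auto
    show ?thesis
    proof (cases "u = lead ord s")
      case True
      then show ?thesis using u bw q by (simp add: ord_refl plug_in_bwords)
    next
      case False
      with lead(2)[OF u(1)] bw q u show ?thesis
        using monomial_order unfolding monomial_order_def by blast
    qed
  qed
qed

text \<open>\<open>B'\<close> is a bound common to all words of \<open>B\<close>; this is what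
  allows their decompositions to be added.\<close>

lemma reduction_linear:
  assumes "\<And>v. v \<in> B \<Longrightarrow> \<exists>t r. monomial v = t + r \<and> t \<in> rspan X ord S B' \<and> keys r \<subseteq> Irr X ord S"
    and "keys f \<subseteq> B"
  shows "\<exists>t r. f = t + r \<and> t \<in> rspan X ord S B' \<and> keys r \<subseteq> Irr X ord S"
  using assms(2)
proof (induction f rule: linear_induct)
  case zero
  show ?case by (rule exI[of _ 0])+ (simp add: rspan.zero)
next
  case (add f g)
  then obtain t r t' r' where "f = t + r" "t \<in> rspan X ord S B'" "keys r \<subseteq> Irr X ord S"
    "g = t' + r'" "t' \<in> rspan X ord S B'" "keys r' \<subseteq> Irr X ord S" by blast
  then show ?case
    by (intro exI[of _ "t + t'"] exI[of _ "r + r'"]) (simp add: rspan_add keys_add_subset)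
next
  case (monomial c v)
  then obtain t r where "Defs.monomial v = t + r" "t \<in> rspan X ord S B'" "keys r \<subseteq> Irr X ord S"
    using assms(1) by blast
  then show ?case
    by (intro exI[of _ "scale c t"] exI[of _ "scale c r"]) (simp add: rspan_scale keys_scale_subset scale_add)
qed

lemma reduction:
  assumes "w \<in> bwords X"
  shows "\<exists>t r. monomial w = t + r \<and> t \<in> rspan X ord S {v. (v, w) \<in> ord} \<and> keys r \<subseteq> Irr X ord S"
  using wf_ord assms
proof (induction w rule: wf_induct_rule)
  case (less w)
  show ?case
  proof (cases "w \<in> Irr X ord S")
    case True
    then show ?thesis by (intro exI[of _ 0] exI[of _ "monomial w"]) (simp add: rspan.zero)
  next
    case False
    with less.prems obtain q s where qs: "q \<in> star_words X" "s \<in> S" and w: "w = plug q (lead ord s)"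
      unfolding Irr_def by blast
    \<comment> \<open>Both terms have coefficient 1 at \<open>w\<close>, so \<open>w\<close> cancels
      without dividing in the coefficient ring, and all remaining words are strictly
      smaller.\<close>
    have sub: "keys (monomial w - plug_lin q s) \<subseteq> {v \<in> bwords X. (v, w) \<in> ord - Id}"
    proof
      fix v assume v: "v \<in> keys (monomial w - plug_lin q s)"
      then have "v \<noteq> w"
        using plug_lin_lead(1)[OF qs] by (auto simp: in_keys_iff lookup_minus lookup_monomial w)
      with v have "v \<in> keys (plug_lin q s)"
        by (simp add: in_keys_iff lookup_minus lookup_monomial)
      with \<open>v \<noteq> w\<close> show "v \<in> {v \<in> bwords X. (v, w) \<in> ord - Id}"
        using plug_lin_lead(2)[OF qs] keys_plug_lin[OF qs] w by auto
    qed
    have IH: "\<exists>t r. monomial v = t + r \<and> t \<in> rspan X ord S {v. (v, w) \<in> ord} \<and> keys r \<subseteq> Irr X ord S"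
      if v: "v \<in> {v \<in> bwords X. (v, w) \<in> ord - Id}" for v
    proof -
      have "{u. (u, v) \<in> ord} \<subseteq> {u. (u, w) \<in> ord}" using v ord_trans by blast
      with less.IH[of v] v show ?thesis using rspan_mono by blast
    qed
    from reduction_linear[OF IH sub] obtain t r
      where tr: "monomial w - plug_lin q s = t + r" "t \<in> rspan X ord S {v. (v, w) \<in> ord}" "keys r \<subseteq> Irr X ord S"
      by blast
    have "t + scale 1 (plug_lin q s) \<in> rspan X ord S {v. (v, w) \<in> ord}"
      by (intro rspan.step tr qs) (use ord_refl[OF less.prems] w in simp)
    moreover have "monomial w = (t + plug_lin q s) + r"
      using tr(1) by (simp add: algebra_simps)
    ultimately show ?thesis using tr(3) by auto
  qed
qed

section \<open>Consequences of independence: trivial compositions and a basis\<close>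

context
  fixes I :: "(('x, 'w) bword \<Rightarrow>\<^sub>0 'k) set"
  assumes ideal: "operated_ideal I (bword_algebra X)" and subset: "S \<subseteq> I"
    and independent: "\<And>r. r \<in> I \<Longrightarrow> keys r \<subseteq> Irr X ord S \<Longrightarrow> r = 0"
begin

text \<open>The common form of both kinds of composition. The two instances have coefficient 1 at
  the same leading word \<open>w\<close>, so only words strictly below \<open>w\<close> remain to be
  reduced.\<close>

lemma difference_trivial_mod:
  assumes q: "p \<in> star_words X" "q \<in> star_words X" and s: "f \<in> S" "g \<in> S"
    and w: "w = plug p (lead ord f)" "w = plug q (lead ord g)"
  shows "trivial_mod X ord S w (plug_lin p f - plug_lin q g)"
proof -
  let ?h = "plug_lin p f - plug_lin q g"
  have sub: "keys ?h \<subseteq> {v \<in> bwords X. (v, w) \<in> ord - Id}"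
  proof
    fix v assume v: "v \<in> keys ?h"
    then have "v \<noteq> w"
      using plug_lin_lead(1)[OF q(1) s(1)] plug_lin_lead(1)[OF q(2) s(2)] w
      by (auto simp: in_keys_iff lookup_minus)
    moreover have "v \<in> keys (plug_lin p f) \<union> keys (plug_lin q g)" by (rule subsetD[OF keys_diff v])
    ultimately show "v \<in> {v \<in> bwords X. (v, w) \<in> ord - Id}"
      using plug_lin_lead(2)[OF q(1) s(1)] plug_lin_lead(2)[OF q(2) s(2)]
        keys_plug_lin[OF q(1) s(1)] keys_plug_lin[OF q(2) s(2)] w by auto
  qed
  have "\<exists>t r. monomial v = t + r \<and> t \<in> rspan X ord S {v. (v, w) \<in> ord - Id} \<and> keys r \<subseteq> Irr X ord S"
    if v: "v \<in> {v \<in> bwords X. (v, w) \<in> ord - Id}" for v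
  proof -
    \<comment> \<open>Were u = w, then v and w would bound each other and be equal. Hence every word
      up to \<open>v\<close> is strictly below \<open>w\<close>, as the strict bound in
      \<open>trivial_mod\<close> demands.\<close>
    have "{u. (u, v) \<in> ord} \<subseteq> {u. (u, w) \<in> ord - Id}"
      using v ord_trans ord_antisym by blast
    with reduction[of v] v show ?thesis using rspan_mono by blast
  qed
  from reduction_linear[OF this sub] obtain t r
    where tr: "?h = t + r" "t \<in> rspan X ord S {v. (v, w) \<in> ord - Id}" "keys r \<subseteq> Irr X ord S"
    by blast
  note ID = operated_ideal_bword_algebraD[OF ideal]
  have "?h \<in> I" using q s subset plug_lin_in_operated_ideal[OF ideal] ID(4) by blast
  moreover have "t \<in> I" by (rule rspan_subset_ideal[OF ideal subset tr(2)])
  ultimately have "r \<in> I" using ID(4)[of ?h t] tr(1) by simp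
  then have "r = 0" using tr(3) by (rule independent)
  with tr show ?thesis by (simp add: rspan_trivial_mod)
qed

theorem groebner_shirshov_basis_of_independent: "groebner_shirshov_basis X ord S"
  unfolding groebner_shirshov_basis_def
proof (intro conjI ballI allI impI)
  fix f g w h assume fg: "f \<in> S" "g \<in> S"
    and "intersection_composition X ord f g w h \<or> including_composition X ord f g w h"
  then consider (int) u v where "u \<in> bwords X" "v \<in> bwords X" "w = lead ord f @ u" "w = v @ lead ord g"
      "h = f * monomial u - monomial v * g"
    | (inc) q where "q \<in> star_words X" "w = lead ord f" "w = plug q (lead ord g)" "h = f - plug_lin q g"
    unfolding intersection_composition_def including_composition_def by blast
  then show "trivial_mod X ord S w h"
  proof cases
    case int
    \<comment> \<open>The contexts of an overlap are the star followed by \<open>u\<close> and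
      \<open>v\<close> followed by the star.\<close>
    have "h = plug_lin (emb [] @ Letter None # emb u) f - plug_lin (emb v @ Letter None # emb []) g"
      unfolding plug_lin_star using int(5) by simp
    then show ?thesis
      using int fg by (simp only:) (intro difference_trivial_mod star_words_starI; simp)
  next
    case inc
    \<comment> \<open>Here \<open>f\<close> is substituted into the bare star, so its ambiguity is
      its own leading word.\<close>
    have "h = plug_lin (emb [] @ Letter None # emb []) f - plug_lin q g"
      unfolding plug_lin_star using inc(4) by simp
    then show ?thesis
      using inc fg by (simp only:) (intro difference_trivial_mod star_words_starI; simp)
  qed
qed (use monic keys_subset in auto)

theorem is_basis_Irr:
  "is_basis (quotient_algebra (bword_algebra X) I) (\<lambda>w. I +>\<^bsub>bword_algebra X\<^esub> monomial w) (Irr X ord S)"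
proof -
  let ?Q = "quotient_algebra (bword_algebra X) I" and ?c = "\<lambda>f. I +>\<^bsub>bword_algebra X\<^esub> f"
  note quot = operated_algebra.quotient_algebra_simps[OF operated_algebra_bword_algebra ideal]
  have Irr: "Irr X ord S \<subseteq> bwords X" by (auto simp: Irr_def)
  have lin: "lin_comb ?Q (\<lambda>w. ?c (monomial w)) c = ?c c" if "keys c \<subseteq> Irr X ord S" for c
    using that Irr by (intro lin_comb_coset[OF ideal]) blast
  show ?thesis
    unfolding is_basis_def lin_comb_def[symmetric]
  proof (intro conjI ballI allI impI)
    show "(\<lambda>w. ?c (monomial w)) \<in> Irr X ord S \<rightarrow> carrier ?Q"
      using Irr by (auto simp: quot(1))
  next
    fix a assume "a \<in> carrier ?Q"
    then obtain f where f: "keys f \<subseteq> bwords X" "a = ?c f" by (auto simp: quot(1))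
    \<comment> \<open>Spanning is a statement modulo \<open>I\<close> only, so the bound on the
      leading words is relaxed to \<open>UNIV\<close>.\<close>
    have "\<exists>t r. monomial w = t + r \<and> t \<in> rspan X ord S UNIV \<and> keys r \<subseteq> Irr X ord S" if "w \<in> bwords X" for w
      using reduction[OF that] rspan_mono by blast
    from reduction_linear[OF this f(1)] obtain t r
      where tr: "f = t + r" "t \<in> rspan X ord S UNIV" "keys r \<subseteq> Irr X ord S" by blast
    have "t \<in> I" by (rule rspan_subset_ideal[OF ideal subset tr(2)])
    then have "?c f = ?c r"
      using f tr Irr by (subst coset_eq_iff[OF ideal]) auto
    with lin[OF tr(3)] f tr(3) show "\<exists>c. keys c \<subseteq> Irr X ord S \<and> a = lin_comb ?Q (\<lambda>w. ?c (monomial w)) c"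
      by auto
  next
    fix c assume c: "keys c \<subseteq> Irr X ord S" "lin_comb ?Q (\<lambda>w. ?c (monomial w)) c = \<zero>\<^bsub>?Q\<^esub>"
    then have "?c c = ?c 0" by (simp add: lin quot(2))
    then have "c \<in> I" using coset_eq_iff[OF ideal, of c 0] c(1) Irr by auto
    then show "c = 0" using c(1) by (rule independent)
  qed
qed

end

end

text \<open>Each of the three words has degree \<open>deg_word u + deg_word v + 2\<close>; the
  product of the two brackets wins by breadth, whatever \<open>rX\<close> and \<open>rW\<close>
  are.\<close>

lemma RB_relation_lead:
  fixes Om :: "'w four_ops" and \<alpha> \<beta> :: 'w
  assumes "monomial_order X (db_order X rX rW)" "u \<in> bwords X" "v \<in> bwords X"
  defines "s \<equiv> RB_relation Om \<alpha> \<beta> (monomial u) (monomial v) :: ('x, 'w) bword \<Rightarrow>\<^sub>0 'k::comm_ring_1"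
  shows "lead (db_order X rX rW) s = [Bracket \<alpha> u, Bracket \<beta> v]" "monic (db_order X rX rW) s"
proof -
  let ?ord = "db_order X rX rW" and ?w = "[Bracket \<alpha> u, Bracket \<beta> v]"
  have lin: "linear_order_on (bwords X) ?ord"
    using assms(1) by (simp add: monomial_order_def well_order_on_def)
  \<comment> \<open>The two subtracted words may coincide, but they have breadth 1 and so cannot
    affect the coefficient at \<open>?w\<close>.\<close>
  have one: "lookup s ?w = 1"
    unfolding s_def RB_relation_monomial by (simp add: lookup_minus lookup_monomial)
  then have ne: "s \<noteq> 0" and mem: "?w \<in> keys s" by (auto simp: in_keys_iff)
  have sub: "keys s \<subseteq> bwords X" unfolding s_def using assms(2,3) by (simp add: keys_RB_relation)
  note lead = lead_greatest[OF lin sub ne]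
  have le: "(x, ?w) \<in> ?ord" if "x \<in> keys s" for x
  proof (cases "x = ?w")
    case False
    with that have "x = [Bracket (\<alpha> \<^bold>\<rightarrow>\<^bsub>Om\<^esub> \<beta>) (Bracket (\<alpha> \<^bold>\<rhd>\<^bsub>Om\<^esub> \<beta>) u # v)] \<or>
        x = [Bracket (\<alpha> \<^bold>\<leftarrow>\<^bsub>Om\<^esub> \<beta>) (u @ [Bracket (\<alpha> \<^bold>\<lhd>\<^bsub>Om\<^esub> \<beta>) v])]"
      unfolding s_def RB_relation_monomial
      by (auto simp: in_keys_iff lookup_minus lookup_monomial split: if_splits)
    then have "db_less rX rW x ?w" by (auto intro!: db_less_db_less_prime.word_breadth)
    then show ?thesis using that sub assms(2,3) by (auto simp: db_order_def)
  qed (use assms(2,3) in \<open>auto simp: db_order_def\<close>)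
  have "antisym ?ord" using lin by (simp add: linear_order_on_def partial_order_on_def)
  with lead(2)[OF mem] le[OF lead(1)] show *: "lead ?ord s = ?w" by (auto dest: antisymD)
  show "monic ?ord s" unfolding monic_def * using ne one by simp
qed

theorem corollary2p18:
  fixes X :: "'x set"
    and Om :: "'w four_ops"
    and rX :: "'x rel"
    and rW :: "'w rel"
  assumes "ext_diassociative_semigroup Om"
    and "well_order_on X rX"
    and "well_order_on UNIV rW"
  shows
    "let ord = db_order X rX rW;
         S = (RB_relations Om X :: (('x, 'w) bword \<Rightarrow>\<^sub>0 'k::comm_ring_1) set);
         I = gen_operated_ideal (bword_algebra X) S;
         Q = quotient_algebra (bword_algebra X) I;
         cls = (\<lambda>w. I +>\<^bsub>bword_algebra X\<^esub> monomial w)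
     in monomial_order X ord \<and>
        groebner_shirshov_basis X ord S \<and>
        free_Omega_RB_algebra TYPE('a) Om X (\<lambda>x. cls [Letter x]) Q \<and>
        is_basis Q cls (Irr X ord S)"
proof -
  interpret ext_diassociative_semigroup Om by fact
  let ?ord = "db_order X rX rW" and ?S = "RB_relations Om X :: (('x, 'w) bword \<Rightarrow>\<^sub>0 'k) set"
  have ord: "monomial_order X ?ord" by (rule monomial_order_db_order[OF assms(2,3)])
  interpret monic_relations X ?ord ?S
  proof
    show "monic ?ord s" if "s \<in> ?S" for s
      using that RB_relation_lead(2)[OF ord] by (auto simp: RB_relations_altdef)
    show "keys s \<subseteq> bwords X" if "s \<in> ?S" for s
      using subsetD[OF RB_relations_subset that] by simp
  qed (rule ord)
  \<comment> \<open>The leading words of the relations are exactly the products of two brackets with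
    contents over \<open>X\<close>, which identifies the irreducible words with
    \<open>reduced_words X\<close>.\<close>
  have leads: "(\<forall>s\<in>?S. P (lead ?ord s)) \<longleftrightarrow> (\<forall>\<alpha> \<beta>. \<forall>u\<in>bwords X. \<forall>v\<in>bwords X. P [Bracket \<alpha> u, Bracket \<beta> v])"
    for P :: "('x, 'w) bword \<Rightarrow> bool"
  proof -
    have "(\<forall>s\<in>?S. P (lead ?ord s)) \<longleftrightarrow> (\<forall>\<alpha> \<beta>. \<forall>u\<in>bwords X. \<forall>v\<in>bwords X.
        P (lead ?ord (RB_relation Om \<alpha> \<beta> (monomial u) (monomial v) :: _ \<Rightarrow>\<^sub>0 'k)))"
      unfolding RB_relations_altdef by blast
    then show ?thesis by (simp add: RB_relation_lead(1)[OF ord])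
  qed
  have "Irr X ?ord ?S = reduced_words X"
    unfolding Irr_def reduced_words_def using leads[of "\<lambda>l. w \<noteq> plug q l" for w q] by simp
  then have independent: "r = 0" if "r \<in> RB_ideal Om X" "keys r \<subseteq> Irr X ?ord ?S" for r
    using that RB_ideal_reduced_eq_0 by simp
  note I = operated_ideal_RB_ideal RB_relations_subset_RB_ideal independent
  show ?thesis
    unfolding Let_def RB_ideal_def[symmetric]
    using ord groebner_shirshov_basis_of_independent[OF I] free_Omega_RB_algebra_quotient is_basis_Irr[OF I]
    by blast
qed

end
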